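(* Let $p$ be an odd prime and $d$ an odd divisor of $p-1$. If $d\to+\infty$ and $\log d=o(\log p/\log\log p)$, then $$\mathcal{A}(p,d)=\frac{dp}{3}+O\!\left(p(\log\log d)^2\right).$$ For any such $d$ (without size restriction), $$\mathcal{A}(p,d)=\frac{dp}{3}+O\!\left(p(\log p)^2\right).$$
   Context: Let $m=(p-1)/d$ and let $\chi$ be an odd Dirichlet character modulo $p$ of order $m$. Define $$\mathcal{A}(p,d)=\frac{1}{p-1}\sum_{N=1}^{p-1}\#\{(n_1,n_2):1\le n_1,n_2\le N,\ \chi(n_1)=\chi(n_2)\}$$ (independent of the choice of $\chi$). *)

theory Defs
  imports "HOL-Number_Theory.Number_Theory" "HOL-Analysis.Analysis"
begin

definition dirichlet_char_mod :: "nat \<Rightarrow> (nat \<Rightarrow> complex) \<Rightarrow> bool" where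
  "dirichlet_char_mod q chi \<longleftrightarrow>
     (\<forall>a b. chi (a * b) = chi a * chi b) \<and>
     (\<forall>a. chi (a + q) = chi a) \<and>
     chi 1 = 1 \<and>
     (\<forall>a. chi a = 0 \<longleftrightarrow> \<not> coprime a q)"

definition char_order :: "nat \<Rightarrow> (nat \<Rightarrow> complex) \<Rightarrow> nat" where
  "char_order q chi = (LEAST k. 0 < k \<and> (\<forall>a. coprime a q \<longrightarrow> chi a ^ k = 1))"

definition odd_char :: "nat \<Rightarrow> (nat \<Rightarrow> complex) \<Rightarrow> bool" where
  "odd_char q chi \<longleftrightarrow> chi (q - 1) = -1"

text \<open>The average A(p,d), computed with the character chi (independent of chi).\<close>
definition calA :: "nat \<Rightarrow> (nat \<Rightarrow> complex) \<Rightarrow> real" where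
  "calA p chi = (1 / real (p - 1)) *
     (\<Sum>N = 1..p - 1. real (card {(n1, n2). n1 \<in> {1..N} \<and> n2 \<in> {1..N} \<and> chi n1 = chi n2}))"

end

(* Fix h in the kernel H of chi, h not 1. Writing max(a,b) = (a + b + |a - b|)/2 and
   p|a - b| = (a - b)^2 + r(p - r) with r = (a - b) mod p shows that the sum of
   p - max(n, hn mod p) over n is (p-1)(4p+1)/12 + p s(h,p), with s(h,p) the Dedekind sum.
   Finite Fourier analysis of the sawtooth bounds the total of |s(h,p)| over H by p T, where
   T sums 1/(ab) over 1 <= a,b < p with chi(a)^2 = chi(b)^2. Trivially T << (log p)^2.

   For T << (loglog d)^2 only a,b <= d matter, since every class of chi^2 has at most 2d elements.
   Cut [1,d] into blocks [y^j, y^(j+1)) with y = log d. If k-fold products from a block stay below p,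
   congruences between them involve genuine integers, and passing to the k-th power of the
   block's share of T loses only a factor (2d)^(1/k), bounded because log d is small compared with
   log p/loglog p. What remains are sums of 1/b over the divisors b >= y^j of a single integer n,
   which decay geometrically in j since the divisors of n carry their harmonic weight on
   b <= (log n)^O(1). *)

theory Submission
  imports Defs
begin

section \<open>Sums over divisors\<close>

lemma harmonic_sum_le: "n \<ge> 1 \<Longrightarrow> (\<Sum>k = 1..n. 1 / real k) \<le> 1 + ln (real n)"
proof (induction n rule: nat_induct_at_least)
  case (Suc n)
  have "ln (real n) - ln (real (Suc n)) \<le> (real n - real (Suc n)) / real (Suc n)"
    using Suc.hyps by (intro ln_diff_le) auto
  then have "ln (real n) + 1 / real (Suc n) \<le> ln (real (Suc n))" by simp
  then show ?case using Suc.IH by simp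
qed simp

lemma sum_inverse_le:
  assumes "x \<ge> 0" "\<And>a. a \<in> A \<Longrightarrow> a > 0 \<and> ln (real a) \<le> x"
  shows "(\<Sum>a\<in>A. 1 / real a) \<le> 1 + x"
proof -
  define N where "N = nat \<lfloor>exp x\<rfloor>"
  have e1: "exp x \<ge> 1" using assms(1) by simp
  have N: "N \<ge> 1" "real N \<le> exp x" using e1 unfolding N_def by (auto simp: le_nat_iff le_floor_iff)
  have "A \<subseteq> {1..N}"
  proof
    fix a assume a: "a \<in> A"
    then have "real a \<le> exp x" using assms(2) ln_le_cancel_iff[of "real a" "exp x"] by simp
    then show "a \<in> {1..N}" using assms(2)[OF a] by (auto simp: N_def le_nat_floor)
  qed
  then have "(\<Sum>a\<in>A. 1 / real a) \<le> (\<Sum>a = 1..N. 1 / real a)" by (intro sum_mono2) auto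
  also have "\<dots> \<le> 1 + ln (real N)" by (rule harmonic_sum_le[OF N(1)])
  also have "ln (real N) \<le> x" using N by (metis ln_exp ln_mono less_le_trans zero_less_one of_nat_0_less_iff One_nat_def Suc_le_lessD)
  finally show ?thesis by simp
qed

text \<open>Compare \<open>ln (n!)\<close> with its expansion into prime powers: every \<open>m \<le> n\<close> divides at
  least \<open>n / (2 * m)\<close> of the numbers up to \<open>n\<close>.\<close>

lemma sum_mangoldt_over_le:
  "(\<Sum>m = 1..n. mangoldt m / real m :: real) \<le> 2 * ln (real n)"
proof (cases "n = 0")
  case False
  have "real n / 2 * (\<Sum>m = 1..n. mangoldt m / real m) = (\<Sum>m = 1..n. mangoldt m * (real n / (2 * real m)))"
    by (simp add: sum_distrib_left mult_ac)
  also have "\<dots> \<le> (\<Sum>m = 1..n. mangoldt m * real (card {j \<in> {1..n}. m dvd j}))"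
  proof (intro sum_mono mult_left_mono mangoldt_nonneg)
    fix m assume m: "m \<in> {1..n}"
    have "(\<lambda>i. m * i) ` {1..n div m} \<subseteq> {j \<in> {1..n}. m dvd j}"
      using m by auto (metis div_mult_self1_is_m less_le_trans less_eq_div_iff_mult_less_eq mult.commute zero_less_one Suc_le_eq)+
    then have "card ((\<lambda>i. m * i) ` {1..n div m}) \<le> card {j \<in> {1..n}. m dvd j}"
      by (intro card_mono) auto
    moreover have "card ((\<lambda>i. m * i) ` {1..n div m}) = n div m"
      using m by (subst card_image) (auto simp: inj_on_def)
    moreover have "n \<le> 2 * m * (n div m)"
    proof -
      have "n = m * (n div m) + n mod m" "n mod m < m" using m by auto
      moreover have "n div m \<ge> 1" using m by (simp add: Suc_le_eq div_greater_zero_iff)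
      then have "m \<le> m * (n div m)" by simp
      ultimately show ?thesis by linarith
    qed
    then have "real n \<le> real (2 * m * (n div m))" by (simp only: of_nat_le_iff)
    then have "real n / (2 * real m) \<le> real (n div m)" using m by (simp add: field_simps)
    ultimately show "real n / (2 * real m) \<le> real (card {j \<in> {1..n}. m dvd j})" by simp
  qed
  also have "\<dots> = (\<Sum>m = 1..n. \<Sum>j = 1..n. if m dvd j then mangoldt m else 0)"
    by (simp add: sum.If_cases Int_def mult.commute)
  also have "\<dots> = (\<Sum>j = 1..n. \<Sum>m = 1..n. if m dvd j then mangoldt m else 0)"
    by (rule sum.swap)
  also have "\<dots> = (\<Sum>j = 1..n. ln (real j))"
  proof (intro sum.cong refl)
    fix j assume j: "j \<in> {1..n}"
    have "{m \<in> {1..n}. m dvd j} = {m. m dvd j}"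
      using j by (auto simp: Suc_le_eq intro!: Nat.gr0I dest: dvd_imp_le)
    then have "(\<Sum>m = 1..n. if m dvd j then mangoldt m else 0) = (\<Sum>m | m dvd j. mangoldt m :: real)"
      by (simp add: sum.If_cases Int_def)
    also have "\<dots> = ln (real j)" using j by (subst mangoldt_sum) auto
    finally show "(\<Sum>m = 1..n. if m dvd j then mangoldt m else 0 :: real) = ln (real j)" .
  qed
  also have "\<dots> \<le> (\<Sum>j = 1..n. ln (real n))" by (intro sum_mono) auto
  finally show ?thesis using False by (simp add: field_simps)
qed simp

lemma divisor_sum_log_le:
  fixes s :: real
  assumes "n > 0"
  shows "(\<Sum>b | b dvd n. real b powr (-s) * ln (real b)) \<le>
         (\<Sum>m | m dvd n. mangoldt m * real m powr (-s)) * (\<Sum>b | b dvd n. real b powr (-s))"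
proof -
  have fin: "finite {b. b dvd n}" using assms by simp
  have "(\<Sum>b | b dvd n. real b powr (-s) * ln (real b)) =
        (\<Sum>b | b dvd n. \<Sum>m | m dvd b. mangoldt m * real b powr (-s))"
  proof (intro sum.cong refl)
    fix b assume "b \<in> {b. b dvd n}"
    then have "b > 0" using assms by (auto intro!: Nat.gr0I)
    then have "(\<Sum>m | m dvd b. mangoldt m) = ln (real b)" by (subst mangoldt_sum) auto
    then show "real b powr (-s) * ln (real b) = (\<Sum>m | m dvd b. mangoldt m * real b powr (-s))"
      by (simp add: sum_distrib_right[symmetric])
  qed
  also have "\<dots> = (\<Sum>(b, m)\<in>(SIGMA b:{b. b dvd n}. {m. m dvd b}). mangoldt m * real b powr (-s))"
    using assms fin by (subst sum.Sigma) (auto intro!: finite_divisors_nat dest: dvd_pos_nat)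
  also have "\<dots> \<le> (\<Sum>(m, c)\<in>{m. m dvd n} \<times> {c. c dvd n}. mangoldt m * real m powr (-s) * real c powr (-s))"
  proof (rule sum_le_included[where i = "\<lambda>(m, c). (m * c, m)"])
    show "finite (SIGMA b:{b. b dvd n}. {m. m dvd b})"
      using assms by (auto intro!: finite_SigmaI finite_divisors_nat dest: dvd_pos_nat)
    show "finite ({m. m dvd n} \<times> {c. c dvd n})" using fin by simp
    show "\<forall>y\<in>{m. m dvd n} \<times> {c. c dvd n}. 0 \<le> (case y of (m, c) \<Rightarrow> mangoldt m * real m powr (-s) * real c powr (-s))"
      by (auto simp: mangoldt_nonneg)
    show "\<forall>x\<in>SIGMA b:{b. b dvd n}. {m. m dvd b}.
            \<exists>y\<in>{m. m dvd n} \<times> {c. c dvd n}. (case y of (m, c) \<Rightarrow> (m * c, m)) = x \<and>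
              (case x of (b, m) \<Rightarrow> mangoldt m * real b powr (-s)) \<le>
              (case y of (m, c) \<Rightarrow> mangoldt m * real m powr (-s) * real c powr (-s))"
    proof
      fix x assume "x \<in> (SIGMA b:{b. b dvd n}. {m. m dvd b})"
      then obtain b m where x: "x = (b, m)" and bm: "b dvd n" "m dvd b" by auto
      then obtain c where c: "b = m * c" by (auto simp: dvd_def)
      have "(m, c) \<in> {m. m dvd n} \<times> {c. c dvd n}" using bm c by (auto intro: dvd_trans)
      then show "\<exists>y\<in>{m. m dvd n} \<times> {c. c dvd n}. (case y of (m, c) \<Rightarrow> (m * c, m)) = x \<and>
              (case x of (b, m) \<Rightarrow> mangoldt m * real b powr (-s)) \<le>
              (case y of (m, c) \<Rightarrow> mangoldt m * real m powr (-s) * real c powr (-s))"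
        by (intro bexI[of _ "(m, c)"]) (auto simp: x c powr_mult mult.assoc)
    qed
  qed
  also have "\<dots> = (\<Sum>m | m dvd n. mangoldt m * real m powr (-s)) * (\<Sum>b | b dvd n. real b powr (-s))"
    by (simp add: sum_product sum.cartesian_product)
  finally show ?thesis .
qed

lemma divisor_sum_mangoldt_le:
  assumes n: "n > 0" and L: "ln L \<ge> 2" "L > 0" "ln (real n) \<le> L"
  defines "s \<equiv> 1 - 1 / ln L"
  shows "(\<Sum>m | m dvd n. mangoldt m * real m powr (-s)) \<le> 9 * ln L"
proof -
  have L1: "L > 1" using L(1,2) by (metis ln_gt_zero_iff less_le_trans zero_less_numeral)
  have Ld: "L powr (1 / ln L) = exp 1" using L L1 by (simp add: powr_def)
  have s: "s > 0" using L L1 by (simp add: s_def)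
  have fin: "finite {b. b dvd n}" using n by simp
  define N where "N = nat \<lfloor>L\<rfloor>"
  have N: "m \<le> N \<longleftrightarrow> real m \<le> L" for m using L1 by (auto simp: N_def le_nat_iff le_floor_iff)
  have 1: "(\<Sum>m | m dvd n \<and> m \<le> N. mangoldt m * real m powr (-s)) \<le> exp 1 * (2 * ln L)"
  proof -
    have "(\<Sum>m | m dvd n \<and> m \<le> N. mangoldt m * real m powr (-s)) \<le> (\<Sum>m | m dvd n \<and> m \<le> N. exp 1 * (mangoldt m / real m))"
    proof (intro sum_mono)
      fix m assume "m \<in> {m. m dvd n \<and> m \<le> N}"
      then have m: "m > 0" "real m \<le> L" using n N by (auto intro!: Nat.gr0I)
      have "real m powr (-s) = real m powr (1 / ln L) / real m" 
        using m by (simp add: s_def powr_diff powr_minus field_simps powr_add[symmetric])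
      also have "\<dots> \<le> L powr (1 / ln L) / real m" using m L by (intro divide_right_mono powr_mono2) auto
      finally have "real m powr (-s) \<le> exp 1 / real m" using Ld by simp
      then have "mangoldt m * real m powr (-s) \<le> mangoldt m * (exp 1 / real m)"
        by (intro mult_left_mono mangoldt_nonneg)
      then show "mangoldt m * real m powr (-s) \<le> exp 1 * (mangoldt m / real m)" by (simp add: mult_ac)
    qed
    also have "\<dots> \<le> (\<Sum>m = 1..N. exp 1 * (mangoldt m / real m))"
      using n by (intro sum_mono2) (auto simp: mangoldt_nonneg Suc_le_eq intro!: Nat.gr0I)
    also have "\<dots> = exp 1 * (\<Sum>m = 1..N. mangoldt m / real m)" by (simp add: sum_distrib_left)
    also have "\<dots> \<le> exp 1 * (2 * ln (real N))" by (intro mult_left_mono sum_mangoldt_over_le) auto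
    also have "\<dots> \<le> exp 1 * (2 * ln L)" using N[of N] N[of 1] L1 by (intro mult_left_mono) auto
    finally show ?thesis .
  qed
  have 2: "(\<Sum>m | m dvd n \<and> \<not> m \<le> N. mangoldt m * real m powr (-s)) \<le> exp 1"
  proof -
    have "(\<Sum>m | m dvd n \<and> \<not> m \<le> N. mangoldt m * real m powr (-s)) \<le> (\<Sum>m | m dvd n \<and> \<not> m \<le> N. mangoldt m * L powr (-s))"
      using N L s by (intro sum_mono mult_left_mono mangoldt_nonneg powr_mono2') auto
    also have "\<dots> \<le> (\<Sum>m | m dvd n. mangoldt m * L powr (-s))"
      using fin by (intro sum_mono2) (auto simp: mangoldt_nonneg)
    also have "\<dots> = ln (real n) * L powr (-s)" using n by (simp add: sum_distrib_right[symmetric] mangoldt_sum)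
    also have "\<dots> \<le> L * L powr (-s)" using L by (intro mult_right_mono) auto
    also have "\<dots> = L powr (1 / ln L)" using L by (simp add: s_def powr_diff powr_minus field_simps)
    finally show ?thesis using Ld by simp
  qed
  have "(\<Sum>m | m dvd n. mangoldt m * real m powr (-s)) =
     (\<Sum>m | m dvd n \<and> m \<le> N. mangoldt m * real m powr (-s)) + (\<Sum>m | m dvd n \<and> \<not> m \<le> N. mangoldt m * real m powr (-s))"
    using fin by (subst sum.union_disjoint[symmetric]) (auto intro!: sum.cong)
  also have "\<dots> \<le> exp 1 * (2 * ln L) + exp 1" using 1 2 by simp
  also have "\<dots> \<le> 3 * (2 * ln L) + 3" using L L1 exp_le by (intro add_mono mult_right_mono) auto
  also have "\<dots> \<le> 9 * ln L" using L by simp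
  finally show ?thesis .
qed

text \<open>Under the weights \<open>b powr (-s)\<close> the mean of \<open>ln b\<close> over the divisors of \<open>n\<close> is at most
  \<open>9 * ln L\<close>, so by Markov's inequality at least half of the weight sits on \<open>b \<le> L powr 18\<close>.\<close>

lemma divisor_sum_powr_le:
  assumes n: "n > 0" and L: "ln L \<ge> 2" "L > 0" "ln (real n) \<le> L"
  defines "s \<equiv> 1 - 1 / ln L"
  shows "(\<Sum>b | b dvd n. real b powr (-s)) \<le> 40 * exp 18 * ln L"
proof -
  have L1: "L > 1" using L(1,2) by (metis ln_gt_zero_iff less_le_trans zero_less_numeral)
  define M where "M = 9 * ln L"
  have M: "M > 0" using L1 by (simp add: M_def)
  define S where "S = (\<Sum>b | b dvd n. real b powr (-s))"
  have S: "S \<ge> 0" unfolding S_def by (intro sum_nonneg) auto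
  have fin: "finite {b. b dvd n}" using n by simp
  have pos: "b > 0" if "b dvd n" for b using that n by (auto intro!: Nat.gr0I)
  have "2 * M * (\<Sum>b | b dvd n \<and> \<not> ln (real b) \<le> 2 * M. real b powr (-s)) \<le>
        (\<Sum>b | b dvd n \<and> \<not> ln (real b) \<le> 2 * M. real b powr (-s) * ln (real b))"
    unfolding sum_distrib_left by (intro sum_mono) (auto simp: mult.commute intro!: mult_right_mono)
  also have "\<dots> \<le> (\<Sum>b | b dvd n. real b powr (-s) * ln (real b))"
    using fin pos by (intro sum_mono2) (auto simp: Suc_le_eq)
  also have "\<dots> \<le> M * S"
    using divisor_sum_log_le[OF n, of s] mult_right_mono[OF divisor_sum_mangoldt_le[OF n L] S]
    unfolding S_def M_def s_def by linarith
  finally have large: "(\<Sum>b | b dvd n \<and> \<not> ln (real b) \<le> 2 * M. real b powr (-s)) \<le> S / 2"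
    using M by (simp add: field_simps)
  have small: "(\<Sum>b | b dvd n \<and> ln (real b) \<le> 2 * M. real b powr (-s)) \<le> exp 18 * (1 + 2 * M)"
  proof -
    have "(\<Sum>b | b dvd n \<and> ln (real b) \<le> 2 * M. real b powr (-s)) \<le>
          (\<Sum>b | b dvd n \<and> ln (real b) \<le> 2 * M. exp 18 * (1 / real b))"
    proof (intro sum_mono)
      fix b assume b: "b \<in> {b. b dvd n \<and> ln (real b) \<le> 2 * M}"
      then have b0: "b > 0" using pos by auto
      have "real b powr (-s) = real b powr (1 / ln L) / real b"
        using b0 by (simp add: s_def powr_diff powr_minus field_simps powr_add[symmetric])
      also have "real b powr (1 / ln L) = exp (ln (real b) / ln L)" using b0 by (simp add: powr_def)
      also have "ln (real b) / ln L \<le> 18"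
        using b L L1 by (simp add: M_def divide_le_eq)
      finally show "real b powr (-s) \<le> exp 18 * (1 / real b)" using b0 by (simp add: divide_right_mono)
    qed
    also have "\<dots> = exp 18 * (\<Sum>b | b dvd n \<and> ln (real b) \<le> 2 * M. 1 / real b)"
      by (simp add: sum_distrib_left)
    also have "\<dots> \<le> exp 18 * (1 + 2 * M)"
      using M pos by (intro mult_left_mono sum_inverse_le) auto
    finally show ?thesis .
  qed
  have "S = (\<Sum>b | b dvd n \<and> ln (real b) \<le> 2 * M. real b powr (-s)) + (\<Sum>b | b dvd n \<and> \<not> ln (real b) \<le> 2 * M. real b powr (-s))"
    unfolding S_def using fin by (subst sum.union_disjoint[symmetric]) (auto intro!: sum.cong)
  then have "S \<le> 2 * (exp 18 * (1 + 2 * M))" using small large by simp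
  also have "\<dots> \<le> 2 * (exp 18 * (20 * ln L))" using L by (intro mult_left_mono) (auto simp: M_def)
  finally show ?thesis by (simp add: S_def mult_ac)
qed

lemma divisor_tail_le:
  assumes n: "n > 0" and L: "ln L \<ge> 2" "L > 0" "ln (real n) \<le> L"
    and B: "\<And>b. b \<in> B \<Longrightarrow> b > 0 \<and> b dvd n \<and> ln (real b) \<ge> y"
  shows "(\<Sum>b\<in>B. 1 / real b) \<le> exp (- (y / ln L)) * (40 * exp 18 * ln L)"
proof -
  have L1: "L > 1" using L(1,2) by (metis ln_gt_zero_iff less_le_trans zero_less_numeral)
  define s where "s = 1 - 1 / ln L"
  have fin: "finite {b. b dvd n}" using n by simp
  have "(\<Sum>b\<in>B. 1 / real b) \<le> (\<Sum>b\<in>B. exp (- (y / ln L)) * real b powr (-s))"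
  proof (intro sum_mono)
    fix b assume "b \<in> B"
    then have b: "b > 0" "ln (real b) \<ge> y" using B by auto
    have "1 / real b = exp (- ln (real b))" using b by (simp add: exp_minus field_simps)
    also have "- ln (real b) = - (ln (real b) / ln L) + - s * ln (real b)"
      using L by (simp add: s_def field_simps)
    also have "exp \<dots> \<le> exp (- (y / ln L) + - s * ln (real b))"
      using b L1 by (simp add: divide_right_mono)
    also have "\<dots> = exp (- (y / ln L)) * real b powr (-s)" using b by (simp only: exp_add powr_def) simp
    finally show "1 / real b \<le> exp (- (y / ln L)) * real b powr (-s)" .
  qed
  also have "\<dots> = exp (- (y / ln L)) * (\<Sum>b\<in>B. real b powr (-s))" by (simp add: sum_distrib_left)
  also have "\<dots> \<le> exp (- (y / ln L)) * (\<Sum>b | b dvd n. real b powr (-s))"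
    using B fin by (intro mult_left_mono sum_mono2) auto
  also have "\<dots> \<le> exp (- (y / ln L)) * (40 * exp 18 * ln L)"
    using divisor_sum_powr_le[OF n L] by (intro mult_left_mono) (auto simp: s_def)
  finally show ?thesis .
qed

section \<open>Pair correlations along the classes of a function\<close>

definition corr :: "('a \<Rightarrow> 'b) \<Rightarrow> ('a \<Rightarrow> real) \<Rightarrow> 'a set \<Rightarrow> real" where
  "corr q f A = (\<Sum>a\<in>A. \<Sum>b\<in>A. if q a = q b then f a * f b else 0)"

lemma corr_group:
  assumes "finite A" "finite I" "g ` A \<subseteq> I"
  shows "corr (\<lambda>a. q (g a)) f A = corr q (\<lambda>n. \<Sum>a | a \<in> A \<and> g a = n. f a) I"
proof -
  have group: "(\<Sum>a\<in>A. h a) = (\<Sum>n\<in>I. \<Sum>a | a \<in> A \<and> g a = n. h a)" for h :: "'a \<Rightarrow> real"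
    by (rule sum.group[OF assms, symmetric])
  have "corr (\<lambda>a. q (g a)) f A =
      (\<Sum>n\<in>I. \<Sum>a | a \<in> A \<and> g a = n. \<Sum>m\<in>I. \<Sum>b | b \<in> A \<and> g b = m. if q (g a) = q (g b) then f a * f b else 0)"
    unfolding corr_def
    by (rule trans[OF group], rule sum.cong[OF refl], rule sum.cong[OF refl], rule group)
  also have "\<dots> = (\<Sum>n\<in>I. \<Sum>a | a \<in> A \<and> g a = n. \<Sum>m\<in>I. \<Sum>b | b \<in> A \<and> g b = m. if q n = q m then f a * f b else 0)"
    by (intro sum.cong refl) auto
  also have "\<dots> = (\<Sum>n\<in>I. \<Sum>m\<in>I. \<Sum>a | a \<in> A \<and> g a = n. \<Sum>b | b \<in> A \<and> g b = m. if q n = q m then f a * f b else 0)"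
    by (rule sum.cong[OF refl], rule sum.swap)
  also have "\<dots> = corr q (\<lambda>n. \<Sum>a | a \<in> A \<and> g a = n. f a) I"
    unfolding corr_def by (intro sum.cong refl) (auto simp: sum_product)
  finally show ?thesis .
qed

lemma corr_eq_sum_squares:
  assumes "finite A" "finite Z" "q ` A \<subseteq> Z"
  shows "corr q f A = (\<Sum>z\<in>Z. (\<Sum>a | a \<in> A \<and> q a = z. f a)\<^sup>2)"
proof -
  have "corr q f A = corr (\<lambda>z. z) (\<lambda>z. \<Sum>a | a \<in> A \<and> q a = z. f a) Z"
    by (rule corr_group[OF assms])
  also have "\<dots> = (\<Sum>z\<in>Z. (\<Sum>a | a \<in> A \<and> q a = z. f a)\<^sup>2)"
    using assms(2) by (simp add: corr_def power2_eq_square)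
  finally show ?thesis .
qed

lemma corr_le_sum_squares:
  fixes K :: real
  assumes "finite A" "\<And>z. real (card {a \<in> A. q a = z}) \<le> K"
  shows "corr q f A \<le> K * (\<Sum>a\<in>A. (f a)\<^sup>2)"
proof -
  have "corr q f A = (\<Sum>z\<in>q ` A. (\<Sum>a | a \<in> A \<and> q a = z. f a * 1)\<^sup>2)"
    using corr_eq_sum_squares[of A "q ` A" q f] assms by simp
  also have "\<dots> \<le> (\<Sum>z\<in>q ` A. K * (\<Sum>a | a \<in> A \<and> q a = z. (f a)\<^sup>2))"
  proof (intro sum_mono)
    fix z
    have "(\<Sum>a | a \<in> A \<and> q a = z. f a * 1)\<^sup>2 \<le>
        (\<Sum>a | a \<in> A \<and> q a = z. (f a)\<^sup>2) * (\<Sum>a | a \<in> A \<and> q a = z. 1\<^sup>2)"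
      by (rule Cauchy_Schwarz_ineq_sum)
    also have "\<dots> \<le> (\<Sum>a | a \<in> A \<and> q a = z. (f a)\<^sup>2) * K"
      using assms(2)[of z] by (intro mult_left_mono) (auto intro: sum_nonneg)
    finally show "(\<Sum>a | a \<in> A \<and> q a = z. f a * 1)\<^sup>2 \<le> K * (\<Sum>a | a \<in> A \<and> q a = z. (f a)\<^sup>2)"
      by (simp add: mult.commute)
  qed
  also have "\<dots> = K * (\<Sum>a\<in>A. (f a)\<^sup>2)"
    using assms(1) by (simp add: sum_distrib_left[symmetric] sum.group)
  finally show ?thesis .
qed

lemma corr_le_weighted_parts:
  assumes "finite A" "finite J" "g ` A \<subseteq> J" "\<And>j. j \<in> J \<Longrightarrow> r j > 0"
  shows "corr q f A \<le> (\<Sum>j\<in>J. r j) * (\<Sum>j\<in>J. corr q f {a \<in> A. g a = j} / r j)"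
proof -
  define x where "x z j = (\<Sum>a | a \<in> {a \<in> A. g a = j} \<and> q a = z. f a)" for z j
  have "corr q f A = (\<Sum>z\<in>q ` A. (\<Sum>a | a \<in> A \<and> q a = z. f a)\<^sup>2)"
    using assms(1) by (intro corr_eq_sum_squares) auto
  also have "\<dots> \<le> (\<Sum>z\<in>q ` A. (\<Sum>j\<in>J. r j) * (\<Sum>j\<in>J. (x z j)\<^sup>2 / r j))"
  proof (intro sum_mono)
    fix z
    have "(\<Sum>a | a \<in> A \<and> q a = z. f a) = (\<Sum>j\<in>J. \<Sum>a | a \<in> {a \<in> A. q a = z} \<and> g a = j. f a)"
      using assms by (subst sum.group) auto
    also have "\<dots> = (\<Sum>j\<in>J. sqrt (r j) * (x z j / sqrt (r j)))"
    proof (intro sum.cong refl)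
      fix j assume "j \<in> J"
      then have "sqrt (r j) > 0" using assms(4) by simp
      moreover have "{a. a \<in> {a \<in> A. q a = z} \<and> g a = j} = {a. a \<in> {a \<in> A. g a = j} \<and> q a = z}" by auto
      ultimately show "(\<Sum>a | a \<in> {a \<in> A. q a = z} \<and> g a = j. f a) = sqrt (r j) * (x z j / sqrt (r j))"
        by (simp add: x_def)
    qed
    finally have "(\<Sum>a | a \<in> A \<and> q a = z. f a)\<^sup>2 = (\<Sum>j\<in>J. sqrt (r j) * (x z j / sqrt (r j)))\<^sup>2" by simp
    also have "\<dots> \<le> (\<Sum>j\<in>J. (sqrt (r j))\<^sup>2) * (\<Sum>j\<in>J. (x z j / sqrt (r j))\<^sup>2)"
      by (rule Cauchy_Schwarz_ineq_sum)
    also have "\<dots> = (\<Sum>j\<in>J. r j) * (\<Sum>j\<in>J. (x z j)\<^sup>2 / r j)"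
      using assms(4) by (simp add: power_divide less_imp_le)
    finally show "(\<Sum>a | a \<in> A \<and> q a = z. f a)\<^sup>2 \<le> (\<Sum>j\<in>J. r j) * (\<Sum>j\<in>J. (x z j)\<^sup>2 / r j)" .
  qed
  also have "\<dots> = (\<Sum>j\<in>J. r j) * (\<Sum>z\<in>q ` A. \<Sum>j\<in>J. (x z j)\<^sup>2 / r j)"
    by (rule sum_distrib_left[symmetric])
  also have "(\<Sum>z\<in>q ` A. \<Sum>j\<in>J. (x z j)\<^sup>2 / r j) = (\<Sum>j\<in>J. (\<Sum>z\<in>q ` A. (x z j)\<^sup>2) / r j)"
    by (subst sum.swap) (simp add: sum_divide_distrib)
  also have "\<dots> = (\<Sum>j\<in>J. corr q f {a \<in> A. g a = j} / r j)"
  proof (rule sum.cong[OF refl])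
    fix j
    have "corr q f {a \<in> A. g a = j} = (\<Sum>z\<in>q ` A. (x z j)\<^sup>2)"
      unfolding x_def using assms(1) by (intro corr_eq_sum_squares) auto
    then show "(\<Sum>z\<in>q ` A. (x z j)\<^sup>2) / r j = corr q f {a \<in> A. g a = j} / r j" by simp
  qed
  finally show ?thesis .
qed

lemma prod_power_multiplicative:
  fixes q :: "nat \<Rightarrow> 'b :: comm_monoid_mult"
  assumes "\<And>a b. q (a * b) = q a * q b" "q 1 = 1" "finite I"
  shows "q (\<Prod>i\<in>I. x i) = (\<Prod>i\<in>I. q (x i))"
  using assms(3) by (induction rule: finite_induct) (use assms(1,2) in auto)

text \<open>\<open>k\<close>-fold products turn the pairs counted by the \<open>k\<close>-th power of the left-hand side into
  pairs from the \<open>q\<close>-classes of \<open>I\<close>, which have at most \<open>K\<close> elements each; so the gain over the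
  trivial bound is only \<open>K\<close> in the \<open>k\<close>-th power.\<close>

lemma corr_power_le:
  fixes q :: "nat \<Rightarrow> 'b :: comm_monoid_mult" and K R :: real
  assumes q: "\<And>a b. q (a * b) = q a * q b" "q 1 = 1"
    and fin: "finite A" "finite I"
    and I: "\<And>x. x \<in> {..<k} \<rightarrow>\<^sub>E A \<Longrightarrow> (\<Prod>i<k. x i) \<in> I"
    and K: "\<And>z. real (card {n \<in> I. q n = z}) \<le> K"
    and R: "\<And>x. x \<in> {..<k} \<rightarrow>\<^sub>E A \<Longrightarrow> (\<Sum>b | b \<in> A \<and> b dvd (\<Prod>i<k. x i). 1 / real b) \<le> R"
  shows "(corr q (\<lambda>a. 1 / real a) A) ^ k \<le> K * ((\<Sum>a\<in>A. 1 / real a) ^ k * R ^ k)"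
proof -
  define M where "M = ({..<k} \<rightarrow>\<^sub>E A)"
  define P where "P x = (\<Prod>i<k. x i)" for x :: "nat \<Rightarrow> nat"
  define f where "f x = 1 / real (P x)" for x
  define S where "S = {x \<in> A \<times> A. q (fst x) = q (snd x)}"
  define w where "w x = 1 / real (fst x) * (1 / real (snd x))" for x :: "nat \<times> nat"
  have finM: "finite M" using fin by (auto simp: M_def intro: finite_PiE)
  have finS: "finite S" using fin by (auto simp: S_def intro: finite_subset[of _ "A \<times> A"])
  have fin_S': "finite ({..<k} \<rightarrow>\<^sub>E S)" using finS by (intro finite_PiE) auto
  have qP: "q (P x) = (\<Prod>i<k. q (x i))" for x
    unfolding P_def by (intro prod_power_multiplicative q) auto
  have f_prod: "f x = (\<Prod>i<k. 1 / real (x i))" for x by (simp add: f_def P_def prod_dividef)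
  have "corr q (\<lambda>a. 1 / real a) A = (\<Sum>x\<in>A \<times> A. if q (fst x) = q (snd x) then w x else 0)"
    unfolding corr_def w_def by (simp add: sum.cartesian_product split_def)
  also have "\<dots> = (\<Sum>x\<in>S. w x)"
    unfolding S_def using fin by (subst sum.inter_filter) auto
  finally have "(corr q (\<lambda>a. 1 / real a) A) ^ k = (\<Prod>i<k. \<Sum>x\<in>S. w x)" by simp
  also have "\<dots> = (\<Sum>g\<in>{..<k} \<rightarrow>\<^sub>E S. \<Prod>i<k. w (g i))"
    using finS by (intro prod_sum_PiE) auto
  also have "\<dots> \<le> (\<Sum>(x, y)\<in>M \<times> M. if q (P x) = q (P y) then f x * f y else 0)"
  proof (rule sum_le_included[where i = "\<lambda>(x, y). \<lambda>i\<in>{..<k}. (x i, y i)"])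
    show "\<forall>g\<in>{..<k} \<rightarrow>\<^sub>E S. \<exists>y\<in>M \<times> M. (case y of (x, y) \<Rightarrow> \<lambda>i\<in>{..<k}. (x i, y i)) = g \<and>
        (\<Prod>i<k. w (g i)) \<le> (case y of (x, y) \<Rightarrow> if q (P x) = q (P y) then f x * f y else 0)"
    proof
      fix g assume g: "g \<in> {..<k} \<rightarrow>\<^sub>E S"
      define x where "x = (\<lambda>i\<in>{..<k}. fst (g i))"
      define y where "y = (\<lambda>i\<in>{..<k}. snd (g i))"
      have gS: "g i \<in> S" if "i < k" for i using g that by auto
      have "(x, y) \<in> M \<times> M" using gS by (auto simp: M_def x_def y_def S_def PiE_iff mem_Times_iff)
      moreover have "(\<lambda>i\<in>{..<k}. (x i, y i)) = g"
        using g by (auto simp: x_def y_def fun_eq_iff PiE_def extensional_def)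
      moreover have "q (P x) = q (P y)"
        unfolding qP using gS by (intro prod.cong) (auto simp: x_def y_def S_def)
      moreover have "(\<Prod>i<k. w (g i)) = f x * f y"
        unfolding f_prod prod.distrib[symmetric]
        by (intro prod.cong) (simp_all add: w_def x_def y_def)
      ultimately show "\<exists>y\<in>M \<times> M. (case y of (x, y) \<Rightarrow> \<lambda>i\<in>{..<k}. (x i, y i)) = g \<and>
        (\<Prod>i<k. w (g i)) \<le> (case y of (x, y) \<Rightarrow> if q (P x) = q (P y) then f x * f y else 0)"
        by (intro bexI[of _ "(x, y)"]) simp_all
    qed
  qed (use fin_S' finM in \<open>auto simp: f_def\<close>)
  also have "\<dots> = corr (\<lambda>x. q (P x)) f M"
    by (simp add: corr_def sum.cartesian_product)
  also have "\<dots> = corr q (\<lambda>n. \<Sum>x | x \<in> M \<and> P x = n. f x) I"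
    using I by (intro corr_group finM fin) (auto simp: P_def M_def)
  also have "\<dots> \<le> K * (\<Sum>n\<in>I. (\<Sum>x | x \<in> M \<and> P x = n. f x)\<^sup>2)"
    by (intro corr_le_sum_squares K fin)
  also have "(\<Sum>n\<in>I. (\<Sum>x | x \<in> M \<and> P x = n. f x)\<^sup>2) =
      (\<Sum>n\<in>I. \<Sum>x | x \<in> M \<and> P x = n. f x * (\<Sum>y | y \<in> M \<and> P y = P x. f y))"
    by (intro sum.cong refl) (simp add: power2_eq_square sum_distrib_right)
  also have "\<dots> = (\<Sum>x\<in>M. f x * (\<Sum>y | y \<in> M \<and> P y = P x. f y))"
    using I by (intro sum.group finM fin) (auto simp: P_def M_def)
  also have "\<dots> \<le> (\<Sum>x\<in>M. f x * R ^ k)"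
  proof (intro sum_mono mult_left_mono)
    fix x assume x: "x \<in> M"
    show "0 \<le> f x" by (simp add: f_def)
    have "(\<Sum>y | y \<in> M \<and> P y = P x. f y) \<le> (\<Sum>y\<in>{..<k} \<rightarrow>\<^sub>E {b \<in> A. b dvd P x}. \<Prod>i<k. 1 / real (y i))"
      unfolding f_prod
    proof (intro sum_mono2)
      show "finite ({..<k} \<rightarrow>\<^sub>E {b \<in> A. b dvd P x})" using fin by (intro finite_PiE) auto
      show "{y. y \<in> M \<and> P y = P x} \<subseteq> {..<k} \<rightarrow>\<^sub>E {b \<in> A. b dvd P x}"
      proof
        fix y assume y: "y \<in> {y. y \<in> M \<and> P y = P x}"
        have "y i dvd P x" if "i < k" for i
        proof -
          have "y i dvd P y" unfolding P_def using that by (intro dvd_prodI) auto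
          then show ?thesis using y by simp
        qed
        then show "y \<in> {..<k} \<rightarrow>\<^sub>E {b \<in> A. b dvd P x}" using y by (auto simp: M_def PiE_def Pi_def)
      qed
    qed (intro prod_nonneg ballI, simp)
    also have "\<dots> = (\<Prod>i<k. \<Sum>b | b \<in> A \<and> b dvd P x. 1 / real b)"
      using fin by (subst prod_sum_PiE) auto
    also have "\<dots> = (\<Sum>b | b \<in> A \<and> b dvd P x. 1 / real b) ^ k" by simp
    also have "\<dots> \<le> R ^ k"
      using R[of x] x unfolding M_def P_def by (intro power_mono sum_nonneg) simp_all
    finally show "(\<Sum>y | y \<in> M \<and> P y = P x. f y) \<le> R ^ k" .
  qed
  also have "\<dots> = (\<Sum>a\<in>A. 1 / real a) ^ k * R ^ k"
  proof -
    have "(\<Sum>x\<in>M. f x) = (\<Prod>i<k. \<Sum>a\<in>A. 1 / real a)"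
      unfolding f_prod M_def using fin by (subst prod_sum_PiE) auto
    then show ?thesis by (simp add: sum_distrib_right[symmetric])
  qed
  finally show ?thesis
    using order_trans[OF of_nat_0_le_iff K] by (simp add: mult_left_mono)
qed

section \<open>The kernel of an odd character\<close>

locale odd_dirichlet_char =
  fixes p d :: nat and chi :: "nat \<Rightarrow> complex"
  assumes prime: "prime p" and odd_p: "odd p" and d_dvd: "d dvd p - 1"
    and char: "dirichlet_char_mod p chi" and order: "char_order p chi = (p - 1) div d"
    and odd_chi: "odd_char p chi"
begin

lemma p_ge_3: "p \<ge> 3"
  using prime odd_p prime_ge_2_nat[of p] by (cases "p = 2") auto

lemma d_pos: "d > 0"
  using d_dvd p_ge_3 by (auto intro!: Nat.gr0I)

lemma d_le: "d \<le> p - 1"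
  using d_dvd p_ge_3 by (intro dvd_imp_le) auto

lemma chi_mult: "chi (a * b) = chi a * chi b"
  using char by (simp add: dirichlet_char_mod_def)

lemma chi_1: "chi (Suc 0) = 1"
  using char by (simp add: dirichlet_char_mod_def)

lemma chi_eq_0_iff: "chi a = 0 \<longleftrightarrow> \<not> coprime a p"
  using char by (simp add: dirichlet_char_mod_def)

lemma coprime_p: "n \<in> {1..p - 1} \<Longrightarrow> coprime n p"
  using prime p_ge_3 by (metis One_nat_def Suc_pred' atLeastAtMost_iff coprime_commute
      le_imp_less_Suc not_less_zero prime_imp_coprime nat_dvd_not_less prime_gt_0_nat zero_less_one
      less_le_trans)

lemma chi_nz: "n \<in> {1..p - 1} \<Longrightarrow> chi n \<noteq> 0"
  using coprime_p chi_eq_0_iff by auto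

lemma chi_add_mult: "chi (a + k * p) = chi a"
proof (induction k)
  case (Suc k)
  have "chi (a + Suc k * p) = chi ((a + k * p) + p)" by (simp add: algebra_simps)
  also have "\<dots> = chi (a + k * p)" using char unfolding dirichlet_char_mod_def by blast
  finally show ?case using Suc by simp
qed simp

lemma chi_mod: "chi (a mod p) = chi a"
  using chi_add_mult[of "a mod p" "a div p"] by simp

lemma chi_power: "chi (a ^ k) = chi a ^ k"
  by (induction k) (use chi_1 in \<open>auto simp: chi_mult\<close>)

lemma bij_betw_mult_mod:
  assumes "n \<in> {1..p - 1}"
  shows "bij_betw (\<lambda>h. (h * n) mod p) {1..p - 1} {1..p - 1}"
proof -
  have inj: "inj_on (\<lambda>h. (h * n) mod p) {1..p - 1}"
  proof (rule inj_onI)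
    fix x y assume xy: "x \<in> {1..p - 1}" "y \<in> {1..p - 1}" "(x * n) mod p = (y * n) mod p"
    then have "[x * n = y * n] (mod p)" unfolding unique_euclidean_semiring_class.cong_def by blast
    then have "[x = y] (mod p)"
      using coprime_p[OF assms] by (metis cong_mult_rcancel_nat coprime_commute)
    moreover have "x < p" "y < p" using xy p_ge_3 by auto
    ultimately show "x = y" by (simp add: unique_euclidean_semiring_class.cong_def)
  qed
  have "(h * n) mod p \<in> {1..p - 1}" if h: "h \<in> {1..p - 1}" for h
  proof -
    have "coprime (h * n) p" using coprime_p[OF h] coprime_p[OF assms] by simp
    then have "\<not> p dvd h * n"
      using prime not_coprimeI[of p] by (metis coprime_common_divisor_nat dvd_refl not_prime_1 nat_dvd_1_iff_1)
    then have "(h * n) mod p \<noteq> 0" by (simp add: dvd_eq_mod_eq_0)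
    moreover have "(h * n) mod p < p" using p_ge_3 by simp
    ultimately show ?thesis by (simp add: Suc_le_eq)
  qed
  then have "(\<lambda>h. (h * n) mod p) ` {1..p - 1} \<subseteq> {1..p - 1}" by auto
  then show ?thesis using inj by (simp add: bij_betw_def endo_inj_surj)
qed

lemma bij_betw_level:
  assumes "n \<in> {1..p - 1}"
  shows "bij_betw (\<lambda>h. (h * n) mod p) {h \<in> {1..p - 1}. chi h = w}
           {m \<in> {1..p - 1}. chi m = w * chi n}"
proof -
  have 1: "chi ((h * n) mod p) = chi h * chi n" for h by (simp add: chi_mod chi_mult)
  have b: "bij_betw (\<lambda>h. (h * n) mod p) {1..p - 1} {1..p - 1}" by (rule bij_betw_mult_mod[OF assms])
  show ?thesis
    unfolding bij_betw_def
  proof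
    show "inj_on (\<lambda>h. (h * n) mod p) {h \<in> {1..p - 1}. chi h = w}"
      using b by (auto simp: bij_betw_def intro: inj_on_subset)
    show "(\<lambda>h. (h * n) mod p) ` {h \<in> {1..p - 1}. chi h = w} = {m \<in> {1..p - 1}. chi m = w * chi n}"
    proof
      show "(\<lambda>h. (h * n) mod p) ` {h \<in> {1..p - 1}. chi h = w} \<subseteq> {m \<in> {1..p - 1}. chi m = w * chi n}"
        using b 1 by (auto simp: bij_betw_def)
      show "{m \<in> {1..p - 1}. chi m = w * chi n} \<subseteq> (\<lambda>h. (h * n) mod p) ` {h \<in> {1..p - 1}. chi h = w}"
      proof
        fix m assume m: "m \<in> {m \<in> {1..p - 1}. chi m = w * chi n}"
        then obtain h where h: "h \<in> {1..p - 1}" "m = (h * n) mod p"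
          using b unfolding bij_betw_def by blast
        have "chi h = w" using m h 1[of h] chi_nz[OF assms] by auto
        then show "m \<in> (\<lambda>h. (h * n) mod p) ` {h \<in> {1..p - 1}. chi h = w}" using h by blast
      qed
    qed
  qed
qed

definition ker :: "nat set" where "ker = {h \<in> {1..p - 1}. chi h = 1}"

lemma card_ker: "card ker = d"
proof -
  obtain g where g: "residue_primroot p g" using prime_primitive_root_exists[OF _ prime] prime_gt_1_nat[OF prime] by blast
  have tot: "totatives p = {1..p - 1}"
    using prime by (simp add: totatives_prime atLeastAtMost_def greaterThanLessThan_def)
      (use p_ge_3 in auto)
  have b: "bij_betw (\<lambda>i. g ^ i mod p) {..<p - 1} {1..p - 1}"
    using residue_primroot_is_generator[OF _ g] prime p_ge_3 tot by (simp add: totient_prime)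
  define z where "z = chi g"
  have chig: "chi (g ^ i mod p) = z ^ i" for i by (simp add: chi_mod chi_power z_def)
  have all_iff: "(\<forall>a. coprime a p \<longrightarrow> chi a ^ k = 1) \<longleftrightarrow> z ^ k = 1" for k
  proof
    assume "\<forall>a. coprime a p \<longrightarrow> chi a ^ k = 1"
    then show "z ^ k = 1" using g by (auto simp: residue_primroot_def z_def coprime_commute)
  next
    assume z: "z ^ k = 1"
    show "\<forall>a. coprime a p \<longrightarrow> chi a ^ k = 1"
    proof (intro allI impI)
      fix a assume a: "coprime a p"
      have "\<not> p dvd a" using a prime by (metis coprime_absorb_right not_prime_unit)
      then have "a mod p \<in> {1..p - 1}" using p_ge_3 by (auto simp: dvd_eq_mod_eq_0 Suc_le_eq less_eq_Suc_le[symmetric]) (metis Suc_pred less_Suc_eq_le mod_less_divisor zero_less_Suc prime prime_gt_0_nat)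
      then obtain i where "a mod p = g ^ i mod p" using b unfolding bij_betw_def by blast
      then have "chi a = z ^ i" by (metis chi_mod chig)
      then show "chi a ^ k = 1" using z by (metis power_mult mult.commute power_one)
    qed
  qed
  define m where "m = (p - 1) div d"
  have m: "m = (LEAST k. 0 < k \<and> z ^ k = 1)"
    using order unfolding m_def char_order_def all_iff by simp
  have zp: "z ^ (p - 1) = 1"
  proof -
    have "[g ^ (p - 1) = 1] (mod p)" using g euler_theorem[of g p] prime by (auto simp: residue_primroot_def totient_prime coprime_commute)
    then have "g ^ (p - 1) mod p = 1" using p_ge_3 by (simp add: unique_euclidean_semiring_class.cong_def)
    then show ?thesis using chig[of "p - 1"] chi_1 by simp
  qed
  have zm: "0 < m \<and> z ^ m = 1"
    unfolding m by (rule LeastI[of _ "p - 1"]) (use zp p_ge_3 in auto)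
  have zi: "z ^ i = 1 \<longleftrightarrow> m dvd i" for i
  proof
    assume i: "z ^ i = 1"
    have "z ^ i = z ^ (m * (i div m) + i mod m)" by simp
    also have "\<dots> = z ^ (i mod m)" using zm by (simp only: power_add power_mult) simp
    finally have "z ^ (i mod m) = 1" using i by simp
    moreover have "i mod m < m" using zm by simp
    ultimately have "i mod m = 0" using not_less_Least[of "i mod m" "\<lambda>k. 0 < k \<and> z ^ k = 1"] m by auto
    then show "m dvd i" by auto
  next
    assume "m dvd i" then show "z ^ i = 1" using zm by (auto simp: power_mult)
  qed
  have md: "p - 1 = m * d" using d_dvd m_def by simp
  have "ker = (\<lambda>i. g ^ i mod p) ` {i \<in> {..<p - 1}. m dvd i}"
    using b unfolding ker_def bij_betw_def by (auto simp: zi[symmetric] chig[symmetric] )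
  then have "card ker = card {i \<in> {..<p - 1}. m dvd i}"
    using b by (auto simp: bij_betw_def intro!: card_image intro: inj_on_subset)
  also have "{i \<in> {..<p - 1}. m dvd i} = (\<lambda>j. m * j) ` {..<d}"
    using zm md by (auto simp: dvd_def)
  also have "card \<dots> = d" using zm by (subst card_image) (auto simp: inj_on_def)
  finally show ?thesis .
qed

lemma card_level: "card {n \<in> {1..p - 1}. chi n = z} \<le> d"
proof (cases "{n \<in> {1..p - 1}. chi n = z} = {}")
  case False
  then obtain n where n: "n \<in> {1..p - 1}" "chi n = z" by auto
  have "card {n \<in> {1..p - 1}. chi n = z} = card ker"
    using bij_betw_same_card[OF bij_betw_level[OF n(1), of 1]] n by (simp add: ker_def)
  then show ?thesis using card_ker by simp
qed (metis card.empty le0)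

definition q :: "nat \<Rightarrow> complex" where "q n = chi n ^ 2"

lemma q_mult: "q (a * b) = q a * q b"
  by (simp add: q_def chi_mult power_mult_distrib)

lemma q_1: "q 1 = 1"
  by (simp add: q_def chi_1)

lemma card_q_level: "card {n \<in> {1..p - 1}. q n = z} \<le> 2 * d"
proof -
  have "{n \<in> {1..p - 1}. q n = z} \<subseteq> {n \<in> {1..p - 1}. chi n = csqrt z} \<union> {n \<in> {1..p - 1}. chi n = - csqrt z}"
    by (auto simp: q_def) (metis power2_eq_iff power2_csqrt)
  then have "card {n \<in> {1..p - 1}. q n = z} \<le> card ({n \<in> {1..p - 1}. chi n = csqrt z} \<union> {n \<in> {1..p - 1}. chi n = - csqrt z})"
    by (intro card_mono) auto
  also have "\<dots> \<le> card {n \<in> {1..p - 1}. chi n = csqrt z} + card {n \<in> {1..p - 1}. chi n = - csqrt z}"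
    by (rule card_Un_le)
  also have "\<dots> \<le> 2 * d" using card_level[of "csqrt z"] card_level[of "- csqrt z"] by simp
  finally show ?thesis .
qed

lemma q_minus:
  assumes "a \<in> {1..p - 1}"
  shows "q (p - a) = q a"
proof -
  have "(p - 1) * a = (p - a) + (a - 1) * p"
  proof -
    obtain b where b: "a = Suc b" using assms by (cases a) auto
    obtain c where c: "p = a + c" using assms le_Suc_ex[of a p] by fastforce
    show ?thesis unfolding c b by (simp add: algebra_simps)
  qed
  then have "chi (p - a) = chi ((p - 1) * a)" using chi_add_mult[of "p - a" "a - 1"] by simp
  then show ?thesis using odd_chi by (simp add: q_def chi_mult odd_char_def)
qed

end

section \<open>Reduction to Dedekind sums\<close>

lemma sum_real_upto: "(\<Sum>n = 1..k. real n) = real k * (real k + 1) / 2"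
  by (induction k) (auto simp: field_simps)

lemma sum_squares_upto: "(\<Sum>n = 1..k. (real n)\<^sup>2) = real k * (real k + 1) * (2 * real k + 1) / 6"
  by (induction k) (auto simp: field_simps power2_eq_square)

context odd_dirichlet_char
begin

definition dedekind :: "nat \<Rightarrow> real" where
  "dedekind h = (\<Sum>n = 1..p - 1. (real n / real p - 1 / 2) * (real ((h * n) mod p) / real p - 1 / 2))"

lemma calA_eq_sum_ker:
  "real (p - 1) * calA p chi = (\<Sum>h\<in>ker. \<Sum>n = 1..p - 1. real p - real (max n ((h * n) mod p)))"
proof -
  have "real (p - 1) * calA p chi =
      (\<Sum>N = 1..p - 1. real (card {(n1, n2). n1 \<in> {1..N} \<and> n2 \<in> {1..N} \<and> chi n1 = chi n2}))"
    using p_ge_3 by (simp add: calA_def)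
  also have "\<dots> = (\<Sum>N = 1..p - 1. \<Sum>n = 1..p - 1. \<Sum>m = 1..p - 1.
      if chi m = chi n \<and> max n m \<le> N then 1 else 0)"
  proof (intro sum.cong refl)
    fix N assume N: "N \<in> {1..p - 1}"
    have "(\<Sum>n = 1..p - 1. \<Sum>m = 1..p - 1. if chi m = chi n \<and> max n m \<le> N then 1 else 0 :: real) =
        (\<Sum>(n, m)\<in>{1..p - 1} \<times> {1..p - 1}. if chi m = chi n \<and> max n m \<le> N then 1 else 0)"
      by (simp add: sum.cartesian_product)
    also have "\<dots> = (\<Sum>x\<in>{(n1, n2). n1 \<in> {1..N} \<and> n2 \<in> {1..N} \<and> chi n1 = chi n2}. 1)"
      using N by (intro sum.mono_neutral_cong_right) (auto split: if_splits)
    finally show "real (card {(n1, n2). n1 \<in> {1..N} \<and> n2 \<in> {1..N} \<and> chi n1 = chi n2}) =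
      (\<Sum>n = 1..p - 1. \<Sum>m = 1..p - 1. if chi m = chi n \<and> max n m \<le> N then 1 else 0)" by simp
  qed
  also have "\<dots> = (\<Sum>n = 1..p - 1. \<Sum>N = 1..p - 1. \<Sum>m = 1..p - 1.
      if chi m = chi n \<and> max n m \<le> N then 1 else 0)"
    by (rule sum.swap)
  also have "\<dots> = (\<Sum>n = 1..p - 1. \<Sum>m = 1..p - 1. \<Sum>N = 1..p - 1.
      if chi m = chi n \<and> max n m \<le> N then 1 else 0)"
    by (rule sum.cong[OF refl], rule sum.swap)
  also have "\<dots> = (\<Sum>n = 1..p - 1. \<Sum>m | m \<in> {1..p - 1} \<and> chi m = 1 * chi n. real p - real (max n m))"
  proof (rule sum.cong[OF refl])
    fix n assume n: "n \<in> {1..p - 1}"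
    have "(\<Sum>N = 1..p - 1. if chi m = chi n \<and> max n m \<le> N then 1 else 0 :: real) =
        (if chi m = chi n then real p - real (max n m) else 0)" if m: "m \<in> {1..p - 1}" for m
    proof (cases "chi m = chi n")
      case True
      have "{N \<in> {1..p - 1}. max n m \<le> N} = {max n m..p - 1}" using n m by auto
      then have "card {N \<in> {1..p - 1}. max n m \<le> N} = p - max n m" using p_ge_3 by simp
      moreover have "max n m \<le> p" using n m by auto
      ultimately show ?thesis using True by (simp add: sum.If_cases Int_def of_nat_diff)
    qed simp
    then have "(\<Sum>m = 1..p - 1. \<Sum>N = 1..p - 1. if chi m = chi n \<and> max n m \<le> N then 1 else 0) =
       (\<Sum>m = 1..p - 1. if chi m = chi n then real p - real (max n m) else 0)" by (intro sum.cong refl)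
    also have "\<dots> = (\<Sum>m | m \<in> {1..p - 1} \<and> chi m = 1 * chi n. real p - real (max n m))"
      by (simp add: sum.If_cases Int_def)
    finally show "(\<Sum>m = 1..p - 1. \<Sum>N = 1..p - 1. if chi m = chi n \<and> max n m \<le> N then 1 else 0) =
       (\<Sum>m | m \<in> {1..p - 1} \<and> chi m = 1 * chi n. real p - real (max n m))" .
  qed
  also have "\<dots> = (\<Sum>n = 1..p - 1. \<Sum>h\<in>ker. real p - real (max n ((h * n) mod p)))"
    unfolding ker_def
    by (intro sum.cong refl sum.reindex_bij_betw[symmetric] bij_betw_level)
  also have "\<dots> = (\<Sum>h\<in>ker. \<Sum>n = 1..p - 1. real p - real (max n ((h * n) mod p)))"
    by (rule sum.swap)
  finally show ?thesis .
qed

lemma abs_diff_mod_identity: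
  assumes h: "h \<in> {1..p - 1}" and n: "n \<in> {1..p - 1}"
  defines "m \<equiv> (h * n) mod p" and "r \<equiv> ((p + 1 - h) * n) mod p"
  shows "real p * \<bar>real n - real m\<bar> = (real n - real m)\<^sup>2 + real r * (real p - real r)"
proof -
  have p0: "p > 0" using p_ge_3 by simp
  have hp: "h \<le> p + 1" using h by auto
  have r: "int r = (int n - int m) mod int p"
  proof -
    have "int r = ((int p + 1 - int h) * int n) mod int p"
      using hp by (simp add: r_def zmod_int of_nat_diff add.commute)
    also have "(int p + 1 - int h) * int n = (int n - int h * int n) + int n * int p"
      by (simp add: algebra_simps)
    also have "\<dots> mod int p = (int n - int h * int n) mod int p" by simp
    also have "\<dots> = (int n - int m) mod int p"
      by (simp add: m_def zmod_int mod_diff_right_eq)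
    finally show ?thesis .
  qed
  have m: "m < p" using p0 by (simp add: m_def)
  show ?thesis
  proof (cases "m \<le> n")
    case True
    then have "(int n - int m) mod int p = int n - int m" using n by (intro mod_pos_pos_trivial) auto
    then have r': "real r = real n - real m" using r by (metis of_int_diff of_int_of_nat_eq)
    show ?thesis unfolding r' using True by (simp add: power2_eq_square algebra_simps)
  next
    case False
    have "(int n - int m) mod int p = (int n - int m + int p) mod int p" by simp
    also have "\<dots> = int n - int m + int p" using False m by (intro mod_pos_pos_trivial) auto
    finally have r': "real r = real n - real m + real p" using r by (metis of_int_diff of_int_add of_int_of_nat_eq)
    show ?thesis unfolding r' using False by (simp add: power2_eq_square algebra_simps)
  qed
qed

lemma sum_max_eq_dedekind:
  assumes h: "h \<in> {1..p - 1}" "h \<noteq> 1"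
  shows "(\<Sum>n = 1..p - 1. real p - real (max n ((h * n) mod p))) =
         (real p - 1) * (4 * real p + 1) / 12 + real p * dedekind h"
proof -
  define I where "I = {1..p - 1}"
  define m where "m n = (h * n) mod p" for n
  define r where "r n = ((p + 1 - h) * n) mod p" for n
  have bij: "bij_betw (\<lambda>n. (n * u) mod p) I I" if "u \<in> I" for u
    unfolding I_def by (rule bij_betw_mult_mod) (use that in \<open>simp add: I_def\<close>)
  have bm: "bij_betw m I I" using bij[of h] h by (simp add: I_def m_def[abs_def] mult.commute)
  have "p + 1 - h \<in> I" using h p_ge_3 by (auto simp: I_def)
  then have br: "bij_betw r I I" using bij[of "p + 1 - h"] by (simp add: r_def[abs_def] mult.commute)
  have p1: "real (p - 1) = real p - 1" using p_ge_3 by simp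
  have S1: "(\<Sum>n\<in>I. real n) = real p * (real p - 1) / 2"
    using sum_real_upto[of "p - 1"] unfolding I_def p1 by (simp add: algebra_simps)
  have S2: "(\<Sum>n\<in>I. (real n)\<^sup>2) = (real p - 1) * real p * (2 * real p - 1) / 6"
    using sum_squares_upto[of "p - 1"] unfolding I_def p1 by (simp add: algebra_simps)
  have S1m: "(\<Sum>n\<in>I. real (m n)) = real p * (real p - 1) / 2"
    using sum.reindex_bij_betw[OF bm, of real] S1 by simp
  have S2m: "(\<Sum>n\<in>I. (real (m n))\<^sup>2) = (real p - 1) * real p * (2 * real p - 1) / 6"
    using sum.reindex_bij_betw[OF bm, of "\<lambda>x. (real x)\<^sup>2"] S2 by simp
  have R: "(\<Sum>n\<in>I. real (r n) * (real p - real (r n))) = real p * (real p - 1) * (real p + 1) / 6"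
  proof -
    have "(\<Sum>n\<in>I. real (r n) * (real p - real (r n))) = (\<Sum>n\<in>I. real n * (real p - real n))"
      using sum.reindex_bij_betw[OF br, of "\<lambda>x. real x * (real p - real x)"] by simp
    also have "\<dots> = real p * (\<Sum>n\<in>I. real n) - (\<Sum>n\<in>I. (real n)\<^sup>2)"
      by (simp add: sum_subtractf sum_distrib_left algebra_simps power2_eq_square)
    also have "\<dots> = real p * (real p - 1) * (real p + 1) / 6"
      unfolding S1 S2 by (simp add: field_simps)
    finally show ?thesis .
  qed
  define X where "X = (\<Sum>n\<in>I. real n * real (m n))"
  have cI: "real (card I) = real p - 1" using p1 by (simp add: I_def)
  have "dedekind h = (\<Sum>n\<in>I. real n * real (m n) / (real p)\<^sup>2 - (real n + real (m n)) / (2 * real p) + 1 / 4)"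
    unfolding dedekind_def I_def[symmetric] m_def[symmetric]
    using p_ge_3 by (intro sum.cong refl) (simp add: field_simps power2_eq_square)
  also have "\<dots> = X / (real p)\<^sup>2 - ((\<Sum>n\<in>I. real n) + (\<Sum>n\<in>I. real (m n))) / (2 * real p) + real (card I) / 4"
    by (simp add: X_def sum.distrib sum_subtractf sum_divide_distrib[symmetric])
  also have "\<dots> = X / (real p)\<^sup>2 - (real p - 1) / 4"
    unfolding S1 S1m cI using p_ge_3 by (simp add: field_simps)
  finally have X: "X = (real p)\<^sup>2 * (dedekind h + (real p - 1) / 4)"
    using p_ge_3 by (simp add: field_simps)
  have "real p * (\<Sum>n\<in>I. \<bar>real n - real (m n)\<bar>) =
     (\<Sum>n\<in>I. (real n - real (m n))\<^sup>2 + real (r n) * (real p - real (r n)))"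
    unfolding sum_distrib_left
    using abs_diff_mod_identity[OF h(1)] by (intro sum.cong refl) (simp add: I_def m_def r_def)
  also have "\<dots> = (\<Sum>n\<in>I. (real n)\<^sup>2) + (\<Sum>n\<in>I. (real (m n))\<^sup>2) - 2 * X + (\<Sum>n\<in>I. real (r n) * (real p - real (r n)))"
    unfolding X_def by (simp add: sum.distrib sum_subtractf sum_distrib_left power2_diff mult.assoc)
  also have "\<dots> = real p * ((real p - 1) * (2 * real p - 1) / 6 - 2 * real p * dedekind h)"
    unfolding S2 S2m R X by (simp add: field_simps power2_eq_square)
  finally have D: "(\<Sum>n\<in>I. \<bar>real n - real (m n)\<bar>) = (real p - 1) * (2 * real p - 1) / 6 - 2 * real p * dedekind h"
    using p_ge_3 by simp
  have "(\<Sum>n\<in>I. real p - real (max n (m n))) =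
     (\<Sum>n\<in>I. real p - (real n + real (m n) + \<bar>real n - real (m n)\<bar>) / 2)"
    by (intro sum.cong refl) (auto simp: max_def field_simps abs_if)
  also have "\<dots> = real (card I) * real p - ((\<Sum>n\<in>I. real n) + (\<Sum>n\<in>I. real (m n)) + (\<Sum>n\<in>I. \<bar>real n - real (m n)\<bar>)) / 2"
    by (simp add: sum.distrib sum_subtractf sum_divide_distrib[symmetric])
  also have "\<dots> = (real p - 1) * (4 * real p + 1) / 12 + real p * dedekind h"
    unfolding S1 S1m cI D by (simp add: field_simps)
  finally show ?thesis by (simp add: I_def m_def)
qed

lemma one_in_ker: "1 \<in> ker"
  using chi_1 p_ge_3 by (simp add: ker_def)

lemma finite_ker: "finite ker"
  by (simp add: ker_def)

lemma abs_calA_minus_main_le: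
  "\<bar>calA p chi - real d * real p / 3\<bar> \<le> real p + 2 * (\<Sum>h\<in>ker. \<bar>dedekind h\<bar>)"
proof -
  have p1: "real (p - 1) = real p - 1" using p_ge_3 by simp
  have p3: "real p \<ge> 3" using p_ge_3 by simp
  define E where "E = (\<Sum>h\<in>ker - {1}. dedekind h)"
  have "(\<Sum>n = 1..p - 1. real p - real (max n ((1 * n) mod p))) = (\<Sum>n = 1..p - 1. real p - real n)"
    by (intro sum.cong refl) auto
  also have "\<dots> = (real p - 1) * real p / 2"
    unfolding sum_subtractf sum_real_upto p1 sum_constant card_atLeastAtMost
    using p1 by (simp add: field_simps)
  finally have G1: "(\<Sum>n = 1..p - 1. real p - real (max n ((1 * n) mod p))) = (real p - 1) * real p / 2" .
  have "(\<Sum>h\<in>ker - {1}. \<Sum>n = 1..p - 1. real p - real (max n ((h * n) mod p))) =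
     (\<Sum>h\<in>ker - {1}. (real p - 1) * (4 * real p + 1) / 12 + real p * dedekind h)"
    by (intro sum.cong refl sum_max_eq_dedekind) (auto simp: ker_def)
  also have "\<dots> = (real d - 1) * ((real p - 1) * (4 * real p + 1) / 12) + real p * E"
    using one_in_ker finite_ker card_ker d_pos by (simp add: sum.distrib E_def sum_distrib_left)
  finally have G2: "(\<Sum>h\<in>ker - {1}. \<Sum>n = 1..p - 1. real p - real (max n ((h * n) mod p))) =
     (real d - 1) * ((real p - 1) * (4 * real p + 1) / 12) + real p * E" .
  have "(real p - 1) * calA p chi = (real p - 1) * real p / 2 +
     ((real d - 1) * ((real p - 1) * (4 * real p + 1) / 12) + real p * E)"
    unfolding p1[symmetric] calA_eq_sum_ker sum.remove[OF finite_ker one_in_ker] unfolding p1 G1 G2 ..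
  also have "\<dots> = (real p - 1) * (real p / 2 + (real d - 1) * (4 * real p + 1) / 12 + real p / (real p - 1) * E)"
    using p3 by (simp add: field_simps)
  finally have A: "calA p chi = real p / 2 + (real d - 1) * (4 * real p + 1) / 12 + real p / (real p - 1) * E"
    using p3 by simp
  have eq: "calA p chi - real d * real p / 3 = (real p / 6 + real d / 12 - 1 / 12) + real p / (real p - 1) * E"
    unfolding A by (simp add: field_simps)
  have "\<bar>real p / 6 + real d / 12 - 1 / 12\<bar> \<le> real p"
  proof -
    have "real d \<le> real p - 1" using d_le p1 by (metis of_nat_le_iff)
    then show ?thesis using d_pos p3 by (simp add: abs_le_iff)
  qed
  moreover have "\<bar>real p / (real p - 1) * E\<bar> \<le> 2 * (\<Sum>h\<in>ker. \<bar>dedekind h\<bar>)"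
  proof -
    have "\<bar>E\<bar> \<le> (\<Sum>h\<in>ker - {1}. \<bar>dedekind h\<bar>)" unfolding E_def by (rule sum_abs)
    also have "\<dots> \<le> (\<Sum>h\<in>ker. \<bar>dedekind h\<bar>)" using finite_ker by (intro sum_mono2) auto
    finally have E: "\<bar>E\<bar> \<le> (\<Sum>h\<in>ker. \<bar>dedekind h\<bar>)" .
    have "real p / (real p - 1) \<le> 2" using p3 by (simp add: field_simps)
    then show ?thesis unfolding abs_mult using p3 E by (intro mult_mono) auto
  qed
  ultimately show ?thesis unfolding eq by (intro order_trans[OF abs_triangle_ineq] add_mono)
qed

end

section \<open>Finite Fourier analysis of the sawtooth\<close>

lemma sin_ge_third: "0 \<le> t \<Longrightarrow> t \<le> 2 \<Longrightarrow> sin t \<ge> t / 3" for t :: real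
proof -
  assume t: "0 \<le> t" "t \<le> 2"
  have "\<bar>sin t - (\<Sum>m<3. sin_coeff m * t ^ m)\<bar> \<le> inverse (fact 3) * \<bar>t\<bar> ^ 3"
    by (rule Maclaurin_sin_bound)
  then have "\<bar>sin t - t\<bar> \<le> t ^ 3 / 6"
    using t by (simp add: eval_nat_numeral sin_coeff_def)
  then have "t - t ^ 3 / 6 \<le> sin t" by linarith
  moreover have "t ^ 3 \<le> 4 * t"
  proof -
    have "t * t \<le> 2 * 2" using t by (intro mult_mono) auto
    then have "(t * t) * t \<le> 4 * t" using t by (intro mult_right_mono) auto
    then show ?thesis by (simp add: power3_eq_cube)
  qed
  ultimately show ?thesis by linarith
qed

lemma sin_pi_mult_ge:
  assumes "0 \<le> x" "x \<le> 1"
  shows "sin (pi * x) \<ge> min x (1 - x)"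
proof -
  have *: "sin (pi * y) \<ge> y" if y: "0 \<le> y" "y \<le> 1 / 2" for y
  proof -
    have "pi * y \<le> 4 * (1 / 2)" using y pi_less_4 by (intro mult_mono) auto
    then have "sin (pi * y) \<ge> pi * y / 3" using y by (intro sin_ge_third) auto
    moreover have "3 * y \<le> pi * y" using y pi_gt3 by (intro mult_right_mono) auto
    ultimately show ?thesis by simp
  qed
  show ?thesis
  proof (cases "x \<le> 1 / 2")
    case True
    then show ?thesis using *[of x] assms by simp
  next
    case False
    have "sin (pi * (1 - x)) = sin (pi * x)" by (simp add: right_diff_distrib)
    then show ?thesis using *[of "1 - x"] False assms by simp
  qed
qed

lemma sum_mult_power:
  "(\<Sum>n<N. of_nat n * z ^ n) * (z - 1) = of_nat N * z ^ N - (\<Sum>n = 1..N. z ^ n)" for z :: complex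
  by (induction N) (auto simp: algebra_simps)

lemma corr_add_le:
  assumes "finite A"
  shows "corr q (\<lambda>a. f a + g a) A \<le> 2 * corr q f A + 2 * corr q g A"
proof -
  have sq: "corr q f A = (\<Sum>z\<in>q ` A. (\<Sum>a | a \<in> A \<and> q a = z. f a)\<^sup>2)" for f
    using assms by (intro corr_eq_sum_squares) auto
  have "(x + y)\<^sup>2 \<le> 2 * x\<^sup>2 + 2 * y\<^sup>2" for x y :: real
    using sum_squares_bound[of x y] by (simp add: power2_sum)
  then have "corr q (\<lambda>a. f a + g a) A \<le>
      (\<Sum>z\<in>q ` A. 2 * (\<Sum>a | a \<in> A \<and> q a = z. f a)\<^sup>2 + 2 * (\<Sum>a | a \<in> A \<and> q a = z. g a)\<^sup>2)"
    unfolding sq sum.distrib[of f g] by (intro sum_mono)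
  then show ?thesis unfolding sq by (simp only: sum.distrib sum_distrib_left)
qed

lemma corr_reindex:
  assumes "bij_betw s A A" "\<And>a. a \<in> A \<Longrightarrow> q (s a) = q a"
  shows "corr q (\<lambda>a. f (s a)) A = corr q f A"
proof -
  have "corr q (\<lambda>a. f (s a)) A = (\<Sum>a\<in>A. \<Sum>b\<in>A. if q (s a) = q (s b) then f (s a) * f (s b) else 0)"
    unfolding corr_def using assms(2) by (intro sum.cong refl) auto
  also have "\<dots> = (\<Sum>a\<in>A. \<Sum>b\<in>A. if q (s a) = q b then f (s a) * f b else 0)"
    by (rule sum.cong[OF refl], rule sum.reindex_bij_betw[OF assms(1)])
  also have "\<dots> = corr q f A"
    unfolding corr_def by (rule sum.reindex_bij_betw[OF assms(1)])
  finally show ?thesis .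
qed

context odd_dirichlet_char
begin

definition e :: "nat \<Rightarrow> complex" where "e k = cis (2 * pi * real k / real p)"

definition FT :: "nat \<Rightarrow> complex" where
  "FT a = (\<Sum>n = 1..p - 1. of_real (real n / real p - 1 / 2) * e (a * n))"

lemma norm_e: "norm (e k) = 1"
  by (simp add: e_def)

lemma e_mult: "e (a * b) = e a ^ b"
proof -
  have "cis (2 * pi * real a / real p) ^ b = cis (real b * (2 * pi * real a / real p))" by (rule Complex.DeMoivre)
  also have "real b * (2 * pi * real a / real p) = 2 * pi * real (a * b) / real p" by simp
  finally show ?thesis by (simp only: e_def)
qed

lemma e_eq_iff: "e j = e k \<longleftrightarrow> j mod p = k mod p"
  using complex_root_unity_eq[of p j k] p_ge_3 by (simp add: e_def cis_conv_exp mult_ac)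

lemma e_eq_1_iff: "e k = 1 \<longleftrightarrow> p dvd k"
  using e_eq_iff[of k 0] by (auto simp: e_def dvd_eq_mod_eq_0)

lemma sum_e_powers:
  assumes "z ^ p = 1"
  shows "(\<Sum>a<p. z ^ a) = (if z = 1 then of_nat p else 0 :: complex)"
  using assms geometric_sum[of z p] by auto

lemma FT_mod: "FT (a mod p) = FT a"
proof -
  have "e ((a mod p) * n) = e (a * n)" for n
    by (simp add: e_eq_iff mod_mult_left_eq)
  then show ?thesis by (simp add: FT_def)
qed

lemma dedekind_eq_FT:
  assumes h: "h \<in> {1..p - 1}"
  shows "complex_of_real (dedekind h) = (\<Sum>a<p. FT a * cnj (FT ((h * a) mod p))) / of_nat p"
proof -
  define s where "s n = complex_of_real (real n / real p - 1 / 2)" for n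
  define I where "I = {1..p - 1}"
  have sums: "(\<Sum>a<p. e (a * m) * cnj (e (h * a * n))) = (if m = (h * n) mod p then of_nat p else 0)"
    if m: "m \<in> I" for m n
  proof -
    define z where "z = e m * cnj (e (h * n))"
    have "e (a * m) * cnj (e (h * a * n)) = z ^ a" for a
      using e_mult[of m a] e_mult[of "h * n" a] by (simp add: z_def power_mult_distrib mult_ac)
    moreover have "e k ^ p = 1" for k using e_mult[of k p] e_eq_1_iff[of "k * p"] by simp
    then have "z ^ p = 1" by (simp add: z_def power_mult_distrib flip: complex_cnj_power)
    moreover have "z = 1 \<longleftrightarrow> m = (h * n) mod p"
    proof -
      have u: "e (h * n) * cnj (e (h * n)) = 1"
        using complex_norm_square[of "e (h * n)"] by (simp add: norm_e)
      then have "z = 1 \<longleftrightarrow> e m = e (h * n)"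
        unfolding z_def by (metis mult.commute mult.left_commute mult.right_neutral)
      also have "\<dots> \<longleftrightarrow> m = (h * n) mod p" using m by (auto simp: e_eq_iff I_def)
      finally show ?thesis .
    qed
    ultimately show ?thesis using sum_e_powers[of z] by simp
  qed
  have FT_eq: "FT a = (\<Sum>n\<in>I. s n * e (a * n))" for a by (simp add: FT_def s_def I_def)
  have "(\<Sum>a<p. FT a * cnj (FT ((h * a) mod p))) =
     (\<Sum>a<p. \<Sum>m\<in>I. \<Sum>n\<in>I. s m * s n * (e (a * m) * cnj (e (h * a * n))))"
    unfolding FT_mod unfolding FT_eq cnj_sum sum_product
    by (intro sum.cong refl) (simp add: s_def mult_ac)
  also have "\<dots> = (\<Sum>m\<in>I. \<Sum>a<p. \<Sum>n\<in>I. s m * s n * (e (a * m) * cnj (e (h * a * n))))"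
    by (rule sum.swap)
  also have "\<dots> = (\<Sum>m\<in>I. \<Sum>n\<in>I. \<Sum>a<p. s m * s n * (e (a * m) * cnj (e (h * a * n))))"
    by (rule sum.cong[OF refl], rule sum.swap)
  also have "\<dots> = (\<Sum>m\<in>I. \<Sum>n\<in>I. if m = (h * n) mod p then s m * s n * of_nat p else 0)"
    unfolding sum_distrib_left[symmetric] using sums by (intro sum.cong refl) auto
  also have "\<dots> = (\<Sum>n\<in>I. \<Sum>m\<in>I. if m = (h * n) mod p then s m * s n * of_nat p else 0)"
    by (rule sum.swap)
  also have "\<dots> = (\<Sum>n\<in>I. if (h * n) mod p \<in> I then s ((h * n) mod p) * s n * of_nat p else 0)"
    by (simp add: I_def sum.delta)
  also have "\<dots> = (\<Sum>n\<in>I. s n * s ((h * n) mod p)) * of_nat p"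
    unfolding sum_distrib_right
  proof (rule sum.cong[OF refl])
    fix n assume "n \<in> I"
    then have "(h * n) mod p \<in> I"
      using bij_betw_apply[OF bij_betw_mult_mod h, of n] by (simp add: I_def)
    then show "(if (h * n) mod p \<in> I then s ((h * n) mod p) * s n * of_nat p else 0) =
        s n * s ((h * n) mod p) * of_nat p" by simp
  qed
  also have "(\<Sum>n\<in>I. s n * s ((h * n) mod p)) = of_real (dedekind h)"
    by (simp add: dedekind_def s_def I_def)
  finally show ?thesis using p_ge_3 by simp
qed

lemma FT_0: "FT 0 = 0"
proof -
  have "real (p - 1) = real p - 1" using p_ge_3 by simp
  then have "(\<Sum>n = 1..p - 1. real n / real p - 1 / 2) = 0"
    unfolding sum_subtractf sum_divide_distrib[symmetric] sum_real_upto using p_ge_3 by simp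
  moreover have "FT 0 = of_real (\<Sum>n = 1..p - 1. real n / real p - 1 / 2)"
    by (simp add: FT_def e_def)
  ultimately show ?thesis by simp
qed

lemma norm_FT_le:
  assumes a: "a \<in> {1..p - 1}"
  shows "norm (FT a) \<le> real p / 2 * (1 / real a + 1 / real (p - a))"
proof -
  define z where "z = e a"
  have p0: "p > 0" using p_ge_3 by simp
  have "\<not> p dvd a" using a by (auto dest: dvd_imp_le)
  then have z: "z \<noteq> 1" using e_eq_1_iff by (simp add: z_def)
  have zp: "z ^ p = 1" using e_mult[of a p] e_eq_1_iff[of "a * p"] by (simp add: z_def)
  have geo: "(\<Sum>n<p. z ^ n) = 0" using sum_e_powers[OF zp] z by simp
  have ins: "{..<p} = insert 0 {1..p - 1}" using p0 by auto
  have s1: "(\<Sum>n = 1..p - 1. z ^ n) = -1"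
    using geo unfolding ins by (simp add: eq_neg_iff_add_eq_0 add.commute)
  have "(\<Sum>n<p. of_nat n * z ^ n) * (z - 1) = of_nat p - (\<Sum>n = 1..p. z ^ n)"
    unfolding sum_mult_power zp by simp
  also have "(\<Sum>n = 1..p. z ^ n) = (\<Sum>n = 1..p - 1. z ^ n) + z ^ p"
    using p0 by (cases p) auto
  finally have "(\<Sum>n<p. of_nat n * z ^ n) * (z - 1) = of_nat p" using s1 zp by simp
  then have s2: "(\<Sum>n = 1..p - 1. of_nat n * z ^ n) = of_nat p / (z - 1)"
    unfolding ins using z by (simp add: field_simps)
  have "FT a = (\<Sum>n = 1..p - 1. of_nat n * z ^ n / of_nat p - z ^ n / 2)"
    unfolding FT_def e_mult z_def[symmetric] by (intro sum.cong refl) (simp add: algebra_simps)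
  also have "\<dots> = 1 / (z - 1) + 1 / 2"
    unfolding sum_subtractf sum_divide_distrib[symmetric] s1 s2 using p0 by simp
  also have "\<dots> = (z + 1) / (2 * (z - 1))" using z by (simp add: field_simps)
  finally have "norm (FT a) = norm (z + 1) / (2 * norm (z - 1))" by (simp only: norm_divide norm_mult) simp
  also have "\<dots> \<le> 2 / (2 * norm (z - 1))"
    using norm_triangle_ineq[of z 1] norm_e[of a] by (intro divide_right_mono) (auto simp: z_def)
  finally have 1: "norm (FT a) \<le> 1 / norm (z - 1)" by simp
  define x where "x = real a / real p"
  have x: "0 < x" "x < 1" using a p0 by (auto simp: x_def)
  have "norm (z - 1) = 2 * \<bar>sin (pi * x)\<bar>"
    using dist_exp_i_1[of "2 * pi * x"] by (simp add: z_def e_def cis_conv_exp x_def)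
  moreover have "min x (1 - x) \<le> \<bar>sin (pi * x)\<bar>"
    using sin_pi_mult_ge[of x] x by (intro order_trans[OF _ abs_ge_self]) auto
  ultimately have "norm (z - 1) \<ge> 2 * min x (1 - x)" by simp
  then have "1 / norm (z - 1) \<le> 1 / (2 * min x (1 - x))"
    using x by (intro divide_left_mono mult_pos_pos) auto
  also have "\<dots> \<le> 1 / 2 * (1 / x + 1 / (1 - x))"
    using x by (auto simp: min_def)
  also have "1 - x = real (p - a) / real p"
  proof -
    have "a \<le> p" using a by auto
    then show ?thesis using p0 by (simp add: x_def of_nat_diff field_simps)
  qed
  also have "1 / 2 * (1 / x + 1 / (real (p - a) / real p)) = real p / 2 * (1 / real a + 1 / real (p - a))"
    by (simp add: x_def field_simps)
  finally show ?thesis using 1 by simp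
qed

definition T :: real where "T = corr q (\<lambda>a. 1 / real a) {1..p - 1}"

lemma sum_abs_dedekind_le: "(\<Sum>h\<in>ker. \<bar>dedekind h\<bar>) \<le> real p * T"
proof -
  define I where "I = {1..p - 1}"
  define g where "g a = 1 / real a + 1 / real (p - a)" for a
  have p0: "p > 0" using p_ge_3 by simp
  have ins: "{..<p} = insert 0 I" using p0 by (auto simp: I_def)
  have zI: "0 \<notin> I" "finite I" by (auto simp: I_def)
  have g0: "g a \<ge> 0" for a by (simp add: g_def)
  have "(\<Sum>h\<in>ker. \<bar>dedekind h\<bar>) \<le> (\<Sum>h\<in>ker. (\<Sum>a\<in>I. norm (FT a) * norm (FT ((h * a) mod p))) / real p)"
  proof (intro sum_mono)
    fix h assume "h \<in> ker"
    then have h: "h \<in> {1..p - 1}" by (simp add: ker_def)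
    have "\<bar>dedekind h\<bar> = norm (complex_of_real (dedekind h))" by simp
    also have "\<dots> = norm (\<Sum>a\<in>I. FT a * cnj (FT ((h * a) mod p))) / real p"
      unfolding dedekind_eq_FT[OF h] ins using zI by (simp add: FT_0 norm_divide)
    also have "\<dots> \<le> (\<Sum>a\<in>I. norm (FT a) * norm (FT ((h * a) mod p))) / real p"
      by (intro divide_right_mono order_trans[OF norm_sum]) (simp_all add: norm_mult)
    finally show "\<bar>dedekind h\<bar> \<le> (\<Sum>a\<in>I. norm (FT a) * norm (FT ((h * a) mod p))) / real p" .
  qed
  also have "\<dots> = (\<Sum>a\<in>I. \<Sum>h\<in>ker. norm (FT a) * norm (FT ((h * a) mod p))) / real p"
    unfolding sum_divide_distrib[symmetric] by (subst sum.swap) simp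
  finally have 1: "(\<Sum>h\<in>ker. \<bar>dedekind h\<bar>) \<le>
      (\<Sum>a\<in>I. \<Sum>h\<in>ker. norm (FT a) * norm (FT ((h * a) mod p))) / real p" .
  have "(\<Sum>a\<in>I. \<Sum>h\<in>ker. norm (FT a) * norm (FT ((h * a) mod p))) =
     (\<Sum>a\<in>I. \<Sum>b | b \<in> I \<and> chi b = 1 * chi a. norm (FT a) * norm (FT b))"
    unfolding ker_def I_def
    by (rule sum.cong[OF refl], rule sum.reindex_bij_betw, rule bij_betw_level)
  also have "\<dots> \<le> (\<Sum>a\<in>I. \<Sum>b | b \<in> I \<and> chi b = 1 * chi a. (real p / 2 * g a) * (real p / 2 * g b))"
    using norm_FT_le g0 by (intro sum_mono mult_mono) (auto simp: g_def I_def)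
  also have "\<dots> \<le> (\<Sum>a\<in>I. \<Sum>b | b \<in> I \<and> q a = q b. (real p / 2 * g a) * (real p / 2 * g b))"
    using g0 zI by (intro sum_mono sum_mono2) (auto simp: q_def)
  also have "\<dots> = (\<Sum>a\<in>I. \<Sum>b\<in>I. if q a = q b then (real p / 2 * g a) * (real p / 2 * g b) else 0)"
    by (rule sum.cong[OF refl], rule sum.inter_filter[OF zI(2)])
  also have "\<dots> = (real p)\<^sup>2 / 4 * corr q g I"
    unfolding corr_def sum_distrib_left by (intro sum.cong refl) (simp add: power2_eq_square)
  finally have 2: "(\<Sum>a\<in>I. \<Sum>h\<in>ker. norm (FT a) * norm (FT ((h * a) mod p))) \<le> (real p)\<^sup>2 / 4 * corr q g I" .
  have "corr q g I \<le> 2 * T + 2 * corr q (\<lambda>a. 1 / real (p - a)) I"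
    unfolding g_def[abs_def] T_def I_def[symmetric] using zI by (intro corr_add_le)
  also have "corr q (\<lambda>a. 1 / real (p - a)) I = T"
    unfolding T_def I_def[symmetric]
  proof (rule corr_reindex)
    show "bij_betw (\<lambda>a. p - a) I I"
      by (rule bij_betw_byWitness[where f' = "\<lambda>a. p - a"]) (auto simp: I_def)
    show "q (p - a) = q a" if "a \<in> I" for a using q_minus that by (simp add: I_def)
  qed
  finally have "corr q g I \<le> 4 * T" by simp
  then have "(real p)\<^sup>2 / 4 * corr q g I \<le> (real p)\<^sup>2 / 4 * (4 * T)" by (intro mult_left_mono) auto
  then have "(\<Sum>a\<in>I. \<Sum>h\<in>ker. norm (FT a) * norm (FT ((h * a) mod p))) \<le> (real p * T) * real p"
    using 2 by (simp add: power2_eq_square mult_ac)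
  then have "(\<Sum>a\<in>I. \<Sum>h\<in>ker. norm (FT a) * norm (FT ((h * a) mod p))) / real p \<le> real p * T"
    using p0 by (simp only: pos_divide_le_eq of_nat_0_less_iff)
  with 1 show ?thesis by (rule order_trans)
qed

lemma abs_calA_minus_main_le_T: "\<bar>calA p chi - real d * real p / 3\<bar> \<le> real p * (1 + 2 * T)"
proof -
  have "real p * (1 + 2 * T) = real p + 2 * (real p * T)" by (simp add: algebra_simps)
  then show ?thesis using abs_calA_minus_main_le sum_abs_dedekind_le by linarith
qed

end

section \<open>The bound by the iterated logarithm\<close>

lemma sum_inverse_squares_le:
  assumes "d > 0" "finite A" "\<And>a. a \<in> A \<Longrightarrow> a > d"
  shows "(\<Sum>a\<in>A. (1 / real a)\<^sup>2) \<le> 1 / real d"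
proof -
  have *: "(\<Sum>a = Suc d..d + k. (1 / real a)\<^sup>2) \<le> 1 / real d - 1 / real (d + k)" for k
  proof (induction k)
    case (Suc k)
    have "1 / ((u + 1) * (u + 1)) \<le> 1 / u - 1 / (u + 1)" if "u > 0" for u :: real
    proof -
      have "1 / ((u + 1) * (u + 1)) \<le> 1 / (u * (u + 1))"
        using that by (intro divide_left_mono mult_right_mono mult_pos_pos) auto
      also have "\<dots> = 1 / u - 1 / (u + 1)" using that by (simp add: field_simps)
      finally show ?thesis .
    qed
    from this[of "real (d + k)"] have "(1 / real (Suc (d + k)))\<^sup>2 \<le> 1 / real (d + k) - 1 / real (Suc (d + k))"
      using assms(1) by (simp add: power2_eq_square add_ac)
    then show ?case using Suc by simp
  qed simp
  have "A \<subseteq> {Suc d..d + Max A}" using assms by (auto simp: Suc_le_eq trans_le_add2)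
  then have "(\<Sum>a\<in>A. (1 / real a)\<^sup>2) \<le> (\<Sum>a = Suc d..d + Max A. (1 / real a)\<^sup>2)"
    by (intro sum_mono2) auto
  also have "\<dots> \<le> 1 / real d" using *[of "Max A"] by (smt (verit) divide_nonneg_nonneg of_nat_0_le_iff zero_le_one)
  finally show ?thesis .
qed

context odd_dirichlet_char
begin

lemma T_le_ln_p: "T \<le> (1 + ln (real p))\<^sup>2"
proof -
  have "T \<le> (\<Sum>a = 1..p - 1. \<Sum>b = 1..p - 1. 1 / real a * (1 / real b))"
    unfolding T_def corr_def by (intro sum_mono) auto
  also have "\<dots> = (\<Sum>a = 1..p - 1. 1 / real a)\<^sup>2"
    by (simp only: sum_product power2_eq_square)
  also have "\<dots> \<le> (1 + ln (real p))\<^sup>2"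
    using p_ge_3 by (intro power_mono sum_inverse_le sum_nonneg) auto
  finally show ?thesis .
qed

lemma corr_block_le:
  defines "x \<equiv> ln (real d)"
  defines "l \<equiv> ln x"
  assumes l: "l \<ge> 2" and eta: "48 * (x * ln (ln (real p))) \<le> ln (real p)" and j: "real j * l \<le> x"
    and B: "finite B" "\<And>a. a \<in> B \<Longrightarrow> a > 0 \<and> real j * l \<le> ln (real a) \<and> ln (real a) < (real j + 1) * l"
  shows "corr q (\<lambda>a. 1 / real a) B \<le> 2880 * exp 23 * l\<^sup>2 * exp (- (real j / 6))"
proof -
  have x0: "x > 0"
  proof -
    have "x \<ge> 0" using d_pos by (simp add: x_def)
    moreover have "x \<noteq> 0" using l by (auto simp: l_def)
    ultimately show ?thesis by simp
  qed
  have xl: "x \<ge> 1 + l" using ln_le_minus_one[OF x0] by (simp add: l_def)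
  have dp: "real d \<le> real p" using d_le by simp
  have xp: "x \<le> ln (real p)" unfolding x_def using d_pos dp by simp
  then have llp: "l \<le> ln (ln (real p))" unfolding l_def using x0 by simp
  have lnp: "ln (real p) > 0" using x0 xp by simp
  define w where "w = (real j + 1) * l"
  have w: "w > 0" "w \<le> 2 * x"
  proof -
    show "w > 0" unfolding w_def using l by (intro mult_pos_pos) auto
    show "w \<le> 2 * x" using j xl by (simp add: w_def algebra_simps)
  qed
  have xlp: "48 * (x * l) \<le> ln (real p)"
    using eta mult_left_mono[OF llp, of x] x0 by linarith
  define kap where "kap = min x (ln (real p) / w)"
  have kap1: "kap \<ge> 1"
  proof -
    have "2 * x \<le> 48 * (x * l)" using mult_left_mono[OF l, of x] x0 by linarith
    then have "w \<le> ln (real p)" using xlp w by linarith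
    then show ?thesis using w xl l by (simp add: kap_def)
  qed
  define k where "k = nat \<lfloor>kap\<rfloor>"
  have k: "k \<ge> 1" "real k \<le> kap" "kap \<le> 2 * real k"
  proof -
    show "k \<ge> 1" using kap1 by (simp add: k_def le_nat_iff le_floor_iff)
    show "real k \<le> kap" using kap1 by (simp add: k_def)
    have "kap < real k + 1" using kap1 unfolding k_def by linarith
    then show "kap \<le> 2 * real k" using \<open>k \<ge> 1\<close> by linarith
  qed
  have kw: "real k * w \<le> ln (real p)" "real k \<le> x"
    using k(2) w by (auto simp: kap_def pos_le_divide_eq)
  define L where "L = x ^ 3"
  have L: "ln L = 3 * l" "L > 0" using x0 by (auto simp: L_def l_def ln_realpow)
  have kwL: "real k * w \<le> L"
  proof -
    have "real k * w \<le> x * (2 * x)" using kw w x0 by (intro mult_mono) auto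
    also have "\<dots> = 2 * x\<^sup>2" by (simp add: power2_eq_square)
    also have "\<dots> \<le> x * x\<^sup>2" using xl l by (intro mult_right_mono) auto
    finally show ?thesis by (simp add: L_def power3_eq_cube power2_eq_square)
  qed
  define R where "R = exp (- (real j / 3)) * (40 * exp 18 * (3 * l))"
  have R0: "R \<ge> 0" using l by (simp add: R_def)
  define E where "E = (\<Sum>a\<in>B. 1 / real a)"
  have E0: "E \<ge> 0" by (auto simp: E_def intro: sum_nonneg)
  have E: "E \<le> 2 * w"
  proof -
    have "E \<le> 1 + w" unfolding E_def w_def using B l by (intro sum_inverse_le) (auto intro: less_imp_le)
    moreover have "w \<ge> 1" using l mult_mono[of 1 "real j + 1" 1 l] by (simp add: w_def)
    ultimately show ?thesis by simp
  qed
  have prod: "(\<Prod>i<k. y i) > 0 \<and> ln (real (\<Prod>i<k. y i)) < real k * w" if y: "y \<in> {..<k} \<rightarrow>\<^sub>E B" for y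
  proof -
    have yB: "y i \<in> B" if "i < k" for i using y that by auto
    have "ln (real (\<Prod>i<k. y i)) = (\<Sum>i<k. ln (real (y i)))"
      using yB B(2) unfolding of_nat_prod by (intro ln_prod) auto
    also have "\<dots> < (\<Sum>i<k. w)"
      using yB B(2) k(1) by (intro sum_strict_mono) (auto simp: w_def lessThan_empty_iff)
    finally show ?thesis using yB B(2) by (auto intro!: prod_pos)
  qed
  have pow: "(corr q (\<lambda>a. 1 / real a) B) ^ k \<le> real (2 * d) * (E ^ k * R ^ k)"
    unfolding E_def
  proof (rule corr_power_le[where I = "{1..p - 1}"])
    show "q (a * b) = q a * q b" for a b by (rule q_mult)
    show "q 1 = 1" by (rule q_1)
    show "finite B" by (rule B(1))
    show "real (card {n \<in> {1..p - 1}. q n = z}) \<le> real (2 * d)" for z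
      using card_q_level[of z] by (simp only: of_nat_le_iff)
    fix y assume y: "y \<in> {..<k} \<rightarrow>\<^sub>E B"
    note y' = prod[OF y]
    have "ln (real (\<Prod>i<k. y i)) < ln (real p)" using y' kw by linarith
    moreover have "real (\<Prod>i<k. y i) > 0" using y' by (simp only: of_nat_0_less_iff)
    ultimately have "real (\<Prod>i<k. y i) < real p" using p_ge_3 by (simp only: ln_less_cancel_iff)
    then have "(\<Prod>i<k. y i) < p" by (simp only: of_nat_less_iff)
    moreover have "(\<Prod>i<k. y i) \<ge> 1" using y' by (simp only: Suc_le_eq One_nat_def)
    ultimately show "(\<Prod>i<k. y i) \<in> {1..p - 1}" by simp
    have "(\<Sum>b | b \<in> B \<and> b dvd (\<Prod>i<k. y i). 1 / real b) \<le>
        exp (- ((real j * l) / ln L)) * (40 * exp 18 * ln L)"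
    proof (rule divisor_tail_le)
      show "0 < (\<Prod>i<k. y i)" using y' by blast
      show "ln (real (\<Prod>i<k. y i)) \<le> L" using y' kwL by linarith
    qed (use L l B(2) in auto)
    then show "(\<Sum>b | b \<in> B \<and> b dvd (\<Prod>i<k. y i). 1 / real b) \<le> R"
      using l by (simp add: L R_def)
  qed simp
  define c where "c = exp (ln (real (2 * d)) / real k)"
  have Sk: "Suc (k - 1) = k" using k(1) by simp
  have "c ^ k = real (2 * d)" using d_pos k(1) by (simp add: c_def flip: exp_of_nat_mult)
  then have "(corr q (\<lambda>a. 1 / real a) B) ^ Suc (k - 1) \<le> (c * (E * R)) ^ Suc (k - 1)"
    unfolding Sk power_mult_distrib using pow by simp
  moreover have "0 \<le> c * (E * R)" using E0 R0 by (simp add: c_def)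
  ultimately have 1: "corr q (\<lambda>a. 1 / real a) B \<le> c * (E * R)" by (rule power_le_imp_le_base)
  have 2: "ln (real (2 * d)) / real k \<le> 4 + (real j + 1) / 12"
  proof -
    have xk: "x / kap \<le> 1 + (real j + 1) / 48"
    proof (cases "x \<le> ln (real p) / w")
      case True
      then show ?thesis using x0 by (simp add: kap_def)
    next
      case False
      have "x / kap = x * w / ln (real p)" using False w lnp by (simp add: kap_def min_def)
      also have "\<dots> \<le> (real j + 1) / 48"
        using mult_left_mono[OF xlp, of "real j + 1"] lnp by (simp add: w_def field_simps)
      finally show ?thesis by linarith
    qed
    have "ln (real (2 * d)) = ln 2 + x" using d_pos by (simp add: x_def ln_mult)
    also have "\<dots> \<le> 2 * x" using ln_le_minus_one[of 2] xl l by simp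
    finally have "ln (real (2 * d)) / real k \<le> 2 * x / (kap / 2)"
      using k kap1 x0 by (intro frac_le) auto
    also have "\<dots> = 4 * (x / kap)" by simp
    finally show ?thesis using xk by linarith
  qed
  have "u \<le> 12 * exp (u / 12)" for u :: real
    using exp_ge_add_one_self[of "u / 12"] by linarith
  note 3 = this[of "real j + 1"]
  have "c * (E * R) \<le> exp (4 + (real j + 1) / 12) * (2 * w * R)"
    using 2 E E0 R0 by (intro mult_mono) (auto simp: c_def)
  also have "\<dots> \<le> exp (4 + (real j + 1) / 12) * (2 * (12 * exp ((real j + 1) / 12) * l) * R)"
    unfolding w_def using 3 l R0 by (intro mult_left_mono mult_right_mono) auto
  also have "\<dots> = 2880 * l\<^sup>2 * exp (4 + (real j + 1) / 12 + (real j + 1) / 12 + - (real j / 3) + 18)"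
    unfolding exp_add R_def by (simp add: power2_eq_square)
  also have "\<dots> \<le> 2880 * l\<^sup>2 * exp (23 + - (real j / 6))"
    by (intro mult_left_mono) (auto simp: field_simps)
  also have "\<dots> = 2880 * exp 23 * l\<^sup>2 * exp (- (real j / 6))" unfolding exp_add by simp
  finally show ?thesis using 1 by linarith
qed

lemma T_le_ln_ln_d:
  defines "l \<equiv> ln (ln (real d))"
  assumes l: "l \<ge> 2" and eta: "48 * (ln (real d) * ln (ln (real p))) \<le> ln (real p)"
  shows "T \<le> 1000000 * exp 23 * l\<^sup>2"
proof -
  define f where "f a = 1 / real a" for a
  define I where "I = {1..p - 1}"
  define A where "A = {a \<in> I. (a \<le> d) = True}"
  define rho where "rho = exp (- (1 / 12) :: real)"
  have rho: "0 < rho" "rho \<le> 12 / 13"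
  proof -
    have "exp (1 / 12) \<ge> (13 / 12 :: real)" using exp_ge_add_one_self[of "1 / 12"] by simp
    then show "rho \<le> 12 / 13" by (simp add: rho_def exp_minus field_simps)
  qed (simp add: rho_def)
  have fin: "finite I" "finite A" by (auto simp: A_def I_def)
  have tail: "corr q f {a \<in> I. (a \<le> d) = False} \<le> 2"
  proof -
    have "corr q f {a \<in> I. (a \<le> d) = False} \<le> real (2 * d) * (\<Sum>a | a \<in> I \<and> (a \<le> d) = False. (f a)\<^sup>2)"
    proof (rule corr_le_sum_squares)
      fix z
      have "card {a \<in> {a \<in> I. (a \<le> d) = False}. q a = z} \<le> card {n \<in> {1..p - 1}. q n = z}"
        by (intro card_mono) (auto simp: I_def)
      also have "\<dots> \<le> 2 * d" by (rule card_q_level)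
      finally show "real (card {a \<in> {a \<in> I. (a \<le> d) = False}. q a = z}) \<le> real (2 * d)"
        by (simp only: of_nat_le_iff)
    qed (use fin in auto)
    also have "\<dots> \<le> real (2 * d) * (1 / real d)"
      unfolding f_def using d_pos fin by (intro mult_left_mono sum_inverse_squares_le) auto
    also have "\<dots> = 2" using d_pos by simp
    finally show ?thesis .
  qed
  define g where "g a = nat \<lfloor>ln (real a) / l\<rfloor>" for a
  have block: "corr q f {a \<in> A. g a = j} \<le> 2880 * exp 23 * l\<^sup>2 * rho ^ j * rho ^ j" if "j \<in> g ` A" for j
  proof -
    have ga: "real (g a) * l \<le> ln (real a) \<and> ln (real a) < (real (g a) + 1) * l" if "a \<in> A" for a
    proof -
      have "ln (real a) / l \<ge> 0" using that l by (intro divide_nonneg_nonneg) (auto simp: A_def I_def)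
      then have "real (g a) \<le> ln (real a) / l" "ln (real a) / l < real (g a) + 1"
        unfolding g_def by linarith+
      then show ?thesis using l by (simp add: pos_le_divide_eq pos_divide_less_eq)
    qed
    from that obtain a where a: "a \<in> A" "j = g a" by auto
    have "ln (real a) \<le> ln (real d)" using a by (auto simp: A_def I_def)
    then have "real j * l \<le> ln (real d)" using ga[of a] a by simp
    then have "corr q f {a \<in> A. g a = j} \<le> 2880 * exp 23 * l\<^sup>2 * exp (- (real j / 6))"
      unfolding f_def l_def using l eta fin ga
      by (intro corr_block_le) (auto simp: l_def A_def I_def)
    also have "exp (- (real j / 6)) = rho ^ j * rho ^ j"
      unfolding rho_def exp_of_nat_mult[symmetric] exp_add[symmetric] by (simp add: field_simps)
    finally show ?thesis by (simp add: mult.assoc)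
  qed
  have geo: "(\<Sum>j\<in>g ` A. rho ^ j) \<le> 13"
  proof -
    have "(\<Sum>j\<in>g ` A. rho ^ j) \<le> (\<Sum>j. rho ^ j)"
      using rho fin by (intro sum_le_suminf summable_geometric) auto
    also have "\<dots> = 1 / (1 - rho)" using rho by (intro suminf_geometric) auto
    also have "\<dots> \<le> 13" using rho by (simp add: field_simps)
    finally show ?thesis .
  qed
  have main: "corr q f A \<le> 486720 * exp 23 * l\<^sup>2"
  proof -
    have "corr q f A \<le> (\<Sum>j\<in>g ` A. rho ^ j) * (\<Sum>j\<in>g ` A. corr q f {a \<in> A. g a = j} / rho ^ j)"
      using rho fin by (intro corr_le_weighted_parts) auto
    also have "\<dots> \<le> (\<Sum>j\<in>g ` A. rho ^ j) * (\<Sum>j\<in>g ` A. 2880 * exp 23 * l\<^sup>2 * rho ^ j)"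
      using rho block by (intro mult_left_mono sum_mono sum_nonneg) (auto simp: pos_divide_le_eq)
    also have "\<dots> = 2880 * exp 23 * l\<^sup>2 * ((\<Sum>j\<in>g ` A. rho ^ j) * (\<Sum>j\<in>g ` A. rho ^ j))"
      by (simp add: sum_distrib_left[symmetric])
    also have "\<dots> \<le> 2880 * exp 23 * l\<^sup>2 * (13 * 13)"
      using geo rho by (intro mult_left_mono mult_mono sum_nonneg) auto
    finally show ?thesis by simp
  qed
  have "T \<le> (\<Sum>j\<in>(UNIV :: bool set). 1) * (\<Sum>j\<in>UNIV. corr q f {a \<in> I. (a \<le> d) = j} / 1)"
    unfolding T_def f_def[symmetric] I_def[symmetric]
    using fin by (intro corr_le_weighted_parts) auto
  also have "\<dots> = 2 * (corr q f A + corr q f {a \<in> I. (a \<le> d) = False})"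
    by (simp add: UNIV_bool A_def)
  also have "\<dots> \<le> 2 * (486720 * exp 23 * l\<^sup>2 + 2)" using main tail by simp
  also have "\<dots> \<le> 1000000 * exp 23 * l\<^sup>2"
  proof -
    have "1 * 1 \<le> exp 23 * l\<^sup>2" using l by (intro mult_mono) (auto simp: one_le_power)
    moreover have "2 * (486720 * u + 2) \<le> 1000000 * u" if "1 * 1 \<le> u" for u :: real using that by simp
    ultimately show ?thesis by (simp only: mult.assoc)
  qed
  finally show ?thesis .
qed

end

theorem theorem4p9:
  shows "(\<exists>C D \<eta>. \<eta> > 0 \<and> (\<forall>(p::nat) (d::nat) chi.
            prime p \<and> odd p \<and> odd d \<and> d dvd (p - 1) \<and>
            dirichlet_char_mod p chi \<and> char_order p chi = (p - 1) div d \<and> odd_char p chi \<and>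
            real d \<ge> D \<and> ln (real d) \<le> \<eta> * (ln (real p) / ln (ln (real p)))
            \<longrightarrow> \<bar>calA p chi - real d * real p / 3\<bar> \<le> C * real p * (ln (ln (real d)))^2))
       \<and> (\<exists>C. \<forall>(p::nat) (d::nat) chi.
            prime p \<and> odd p \<and> odd d \<and> d dvd (p - 1) \<and>
            dirichlet_char_mod p chi \<and> char_order p chi = (p - 1) div d \<and> odd_char p chi
            \<longrightarrow> \<bar>calA p chi - real d * real p / 3\<bar> \<le> C * real p * (ln (real p))^2)"
proof
  show "\<exists>C D \<eta>. \<eta> > 0 \<and> (\<forall>(p::nat) (d::nat) chi.
            prime p \<and> odd p \<and> odd d \<and> d dvd (p - 1) \<and>
            dirichlet_char_mod p chi \<and> char_order p chi = (p - 1) div d \<and> odd_char p chi \<and>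
            real d \<ge> D \<and> ln (real d) \<le> \<eta> * (ln (real p) / ln (ln (real p)))
            \<longrightarrow> \<bar>calA p chi - real d * real p / 3\<bar> \<le> C * real p * (ln (ln (real d)))^2)"
  proof (intro exI conjI allI impI)
    show "(1 / 48 :: real) > 0" by simp
    fix p d :: nat and chi
    assume H: "prime p \<and> odd p \<and> odd d \<and> d dvd (p - 1) \<and>
            dirichlet_char_mod p chi \<and> char_order p chi = (p - 1) div d \<and> odd_char p chi \<and>
            real d \<ge> exp (exp 2) \<and> ln (real d) \<le> 1 / 48 * (ln (real p) / ln (ln (real p)))"
    then interpret odd_dirichlet_char p d chi by unfold_locales auto
    have d: "ln (real d) \<ge> exp 2" using H d_pos by (simp add: ln_ge_iff)
    then have l: "ln (ln (real d)) \<ge> 2" by (metis exp_gt_zero less_le_trans ln_ge_iff)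
    have "ln (real d) \<le> ln (real p)" using d_le d_pos p_ge_3 by simp
    then have "ln (ln (real d)) \<le> ln (ln (real p))" using d by (metis exp_gt_zero less_le_trans ln_mono)
    then have "ln (ln (real p)) > 0" using l by linarith
    then have eta: "48 * (ln (real d) * ln (ln (real p))) \<le> ln (real p)" using H by (simp add: field_simps)
    define E where "E = (1000000 * exp 23 :: real)"
    have T: "T \<le> E * (ln (ln (real d)))\<^sup>2" unfolding E_def by (rule T_le_ln_ln_d[OF l eta])
    have "1 \<le> (ln (ln (real d)))\<^sup>2" using l by (simp add: one_le_power)
    then have "1 + 2 * T \<le> (1 + 2 * E) * (ln (ln (real d)))\<^sup>2" using T by (simp add: algebra_simps)
    then have "real p * (1 + 2 * T) \<le> real p * ((1 + 2 * E) * (ln (ln (real d)))\<^sup>2)"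
      by (intro mult_left_mono) auto
    then show "\<bar>calA p chi - real d * real p / 3\<bar> \<le> (1 + 2 * (1000000 * exp 23)) * real p * (ln (ln (real d)))^2"
      using abs_calA_minus_main_le_T unfolding E_def by (simp only: mult_ac)
  qed
next
  show "\<exists>C. \<forall>(p::nat) (d::nat) chi.
            prime p \<and> odd p \<and> odd d \<and> d dvd (p - 1) \<and>
            dirichlet_char_mod p chi \<and> char_order p chi = (p - 1) div d \<and> odd_char p chi
            \<longrightarrow> \<bar>calA p chi - real d * real p / 3\<bar> \<le> C * real p * (ln (real p))^2"
  proof (intro exI allI impI)
    fix p d :: nat and chi
    assume "prime p \<and> odd p \<and> odd d \<and> d dvd (p - 1) \<and>
            dirichlet_char_mod p chi \<and> char_order p chi = (p - 1) div d \<and> odd_char p chi"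
    then interpret odd_dirichlet_char p d chi by unfold_locales auto
    have "exp 1 \<le> real p" using exp_le p_ge_3 by linarith
    then have lp: "1 \<le> ln (real p)" using p_ge_3 by (simp add: ln_ge_iff)
    then have "(1 + ln (real p))\<^sup>2 \<le> (2 * ln (real p))\<^sup>2" by (intro power_mono) auto
    then have "T \<le> 4 * (ln (real p))\<^sup>2" using T_le_ln_p by simp
    moreover have "1 \<le> (ln (real p))\<^sup>2" using lp by (simp add: one_le_power)
    ultimately have "1 + 2 * T \<le> 9 * (ln (real p))\<^sup>2" by linarith
    then have "real p * (1 + 2 * T) \<le> real p * (9 * (ln (real p))\<^sup>2)" by (intro mult_left_mono) auto
    then show "\<bar>calA p chi - real d * real p / 3\<bar> \<le> 9 * real p * (ln (real p))\<^sup>2"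
      using abs_calA_minus_main_le_T by simp
  qed
qed

end
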